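(* Consider the question: does every infinite set $A\subseteq\{0,1\}^*$ in $\mathsf{NP}$ contain a string $w$ with $Kt(w)<|w|$ (equivalently, is the set $\{w\mid Kt(w)\ge|w|\}$ $\mathsf{NP}$-immune)? 1. If the answer is negative, then there is no polynomial-time function $g$ stretching every input of $n$ bits to $n+\omega(\log n)$ bits whose range intersects every infinite $\mathsf{NP}$ set. 2. If the answer is affirmative, then $\mathsf{NP}$ is a proper subclass of $\mathsf{EXP}$.
   Context: $Kt(w)$ is Levin's time-bounded Kolmogorov complexity: the minimum of $|d|+\log t$ over programs $d$ (for a fixed universal machine) that print $w$ in time $t$. A set is $\mathsf{NP}$-immune if it is infinite and has no infinite subset in $\mathsf{NP}$. $\mathsf{EXP}=\bigcup_c\mathrm{DTIME}(2^{n^c})$. *)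

theory Defs
  imports Complex_Main "HOL-Library.Extended_Real" "HOL-Library.Landau_Symbols"
begin

section \<open>Multi-tape Turing machines\<close>

type_synonym word = "bool list"

datatype symbol = Blank | Bit bool | Aux nat

datatype dir = Left | Stay | Right

text \<open>A tape is infinite in both directions and consists of its head position and its contents.\<close>

type_synonym tape = "int \<times> (int \<Rightarrow> symbol)"

type_synonym 'q config = "'q \<times> tape list"

text \<open>
  The program is a table of entries (state, scanned symbols, new state, actions), with one scanned
  symbol and one action per tape. Several entries may share the same state and scanned symbols, so
  machines are nondeterministic in general; a machine halts when no entry applies.
\<close>

record 'q tm =
  tapes :: nat
  table :: "('q \<times> symbol list \<times> 'q \<times> (symbol \<times> dir) list) set"
  start :: 'q
  accepting :: "'q set"

text \<open>
  Finiteness of the table makes the sets of states and of tape symbols that matter finite, although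
  the types they are drawn from may be infinite.
\<close>

definition well_formed :: "'q tm \<Rightarrow> bool" where
  "well_formed M \<longleftrightarrow> tapes M \<ge> 1 \<and> finite (table M) \<and>
     (\<forall>(q, ss, q', acts) \<in> table M. length ss = tapes M \<and> length acts = tapes M)"

definition deterministic :: "'q tm \<Rightarrow> bool" where
  "deterministic M \<longleftrightarrow>
     (\<forall>q ss r r'. (q, ss, r) \<in> table M \<longrightarrow> (q, ss, r') \<in> table M \<longrightarrow> r = r')"

fun scan :: "tape \<Rightarrow> symbol" where
  "scan (h, T) = T h"

fun move :: "dir \<Rightarrow> int \<Rightarrow> int" where
  "move Left h = h - 1"
| "move Stay h = h"
| "move Right h = h + 1"

fun act :: "symbol \<times> dir \<Rightarrow> tape \<Rightarrow> tape" where
  "act (s, m) (h, T) = (move m h, T(h := s))"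

definition step :: "'q tm \<Rightarrow> 'q config \<Rightarrow> 'q config \<Rightarrow> bool" where
  "step M c c' \<longleftrightarrow>
     (\<exists>q ts q' acts. c = (q, ts) \<and> (q, map scan ts, q', acts) \<in> table M \<and>
                     c' = (q', map2 act acts ts))"

definition halted :: "'q tm \<Rightarrow> 'q config \<Rightarrow> bool" where
  "halted M c \<longleftrightarrow> \<not> (\<exists>c'. step M c c')"

definition input_tape :: "word \<Rightarrow> tape" where
  "input_tape x = (0, \<lambda>i. if 0 \<le> i \<and> i < int (length x) then Bit (x ! nat i) else Blank)"

text \<open>The input is on the first tape, with the head on its first symbol; other tapes are blank.\<close>

definition init :: "'q tm \<Rightarrow> word \<Rightarrow> 'q config" where
  "init M x = (start M, input_tape x # replicate (tapes M - 1) (0, \<lambda>_. Blank))"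

text \<open>The output is read off the last tape, from the head position to the right up to the first
  blank.\<close>

definition has_output :: "'q config \<Rightarrow> word \<Rightarrow> bool" where
  "has_output c w \<longleftrightarrow>
     (let (h, T) = last (snd c) in
        (\<forall>i < length w. T (h + int i) = Bit (w ! i)) \<and> T (h + int (length w)) = Blank)"

definition prints_within :: "'q tm \<Rightarrow> word \<Rightarrow> nat \<Rightarrow> word \<Rightarrow> bool" where
  "prints_within M x t w \<longleftrightarrow>
     (\<exists>n \<le> t. \<exists>c. (step M ^^ n) (init M x) c \<and> halted M c \<and> has_output c w)"

text \<open>No computation path, of any nondeterministic choices, is longer than t steps.\<close>

definition halts_within :: "'q tm \<Rightarrow> word \<Rightarrow> nat \<Rightarrow> bool" where
  "halts_within M x t \<longleftrightarrow> (\<forall>n c. (step M ^^ n) (init M x) c \<longrightarrow> n \<le> t)"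

definition accepts :: "'q tm \<Rightarrow> word \<Rightarrow> bool" where
  "accepts M x \<longleftrightarrow> (\<exists>c. (step M)\<^sup>*\<^sup>* (init M x) c \<and> halted M c \<and> fst c \<in> accepting M)"

section \<open>Complexity classes\<close>

definition decides_in_time :: "'q tm \<Rightarrow> word set \<Rightarrow> (nat \<Rightarrow> nat) \<Rightarrow> bool" where
  "decides_in_time M A f \<longleftrightarrow> (\<forall>x. halts_within M x (f (length x)) \<and> (accepts M x \<longleftrightarrow> x \<in> A))"

definition DTIME :: "(nat \<Rightarrow> nat) \<Rightarrow> word set set" where
  "DTIME T = {A. \<exists>(M :: nat tm) f. well_formed M \<and> deterministic M \<and> decides_in_time M A f \<and>
                   (\<lambda>n. real (f n)) \<in> O(\<lambda>n. real (T n))}"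

definition NTIME :: "(nat \<Rightarrow> nat) \<Rightarrow> word set set" where
  "NTIME T = {A. \<exists>(M :: nat tm) f. well_formed M \<and> decides_in_time M A f \<and>
                   (\<lambda>n. real (f n)) \<in> O(\<lambda>n. real (T n))}"

definition NP :: "word set set" where
  "NP = (\<Union>c. NTIME (\<lambda>n. n ^ c))"

definition EXP :: "word set set" where
  "EXP = (\<Union>c. DTIME (\<lambda>n. 2 ^ (n ^ c)))"

definition NP_immune :: "word set \<Rightarrow> bool" where
  "NP_immune A \<longleftrightarrow> infinite A \<and> \<not> (\<exists>B \<subseteq> A. infinite B \<and> B \<in> NP)"

definition poly_time_function :: "(word \<Rightarrow> word) \<Rightarrow> bool" where
  "poly_time_function g \<longleftrightarrow>
     (\<exists>(M :: nat tm) f c. well_formed M \<and> deterministic M \<and>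
        (\<forall>x. prints_within M x (f (length x)) (g x)) \<and>
        (\<lambda>n. real (f n)) \<in> O(\<lambda>n. real (n ^ c)))"

definition stretches_superlog :: "(word \<Rightarrow> word) \<Rightarrow> bool" where
  "stretches_superlog g \<longleftrightarrow>
     (\<exists>s :: nat \<Rightarrow> nat. (\<lambda>n. real (s n)) \<in> \<omega>(\<lambda>n. log 2 (real n)) \<and>
        (\<forall>x. length (g x) \<ge> length x + s (length x)))"

section \<open>Universal machines and time-bounded Kolmogorov complexity\<close>

text \<open>
  A universal machine simulates every deterministic machine M when the input is prefixed by a
  suitable program p for M, with polynomial overhead in time. The input length enters the overhead
  because M may halt without having read its whole input.
\<close>

definition universal :: "nat tm \<Rightarrow> bool" where
  "universal U \<longleftrightarrow> well_formed U \<and> deterministic U \<and>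
     (\<forall>M :: nat tm. well_formed M \<longrightarrow> deterministic M \<longrightarrow>
        (\<exists>p c. \<forall>x t w. prints_within M x t w \<longrightarrow>
                 prints_within U (p @ x) ((length x + t) ^ c + c) w))"

text \<open>The value is \<open>\<infinity>\<close> if no program prints w; this does not happen for universal U.\<close>

definition Kt :: "nat tm \<Rightarrow> word \<Rightarrow> ereal" where
  "Kt U w = Inf {ereal (real (length d) + log 2 (real t)) | d t.
                   t \<ge> 1 \<and> prints_within U d t w}"

definition every_infinite_NP_set_has_Kt_easy_string :: "nat tm \<Rightarrow> bool" where
  "every_infinite_NP_set_has_Kt_easy_string U \<longleftrightarrow>
     (\<forall>A \<in> NP. infinite A \<longrightarrow> (\<exists>w \<in> A. Kt U w < ereal (real (length w))))"

end

theory Submission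
  imports Defs "HOL-Library.Countable"
begin

text \<open>
  The words printed by programs shorter than themselves in time less than \<open>2 ^ n\<close> form a set in
  EXP that misses some word of every length, by counting programs. Its complement is an infinite set
  in EXP all of whose words satisfy \<open>Kt w \<ge> |w|\<close>, so it is not in NP if every
  infinite NP set has a Kt-easy word. Both the inclusion of NP in EXP and the decision procedure for
  this set come from a deterministic depth-first search of the computation tree of a nondeterministic
  machine, which backtracks by undoing steps recorded on an additional tape and hence needs time linear
  in the size of the tree.

  Conversely, if g is computable in polynomial time and stretches by \<open>\<omega>(log n)\<close>, then
  \<open>Kt (g x) \<le> |x| + O(log |x|) < |g x|\<close> for all long x. So an infinite NP set of Kt-hard
  words meets the range of g in finitely many words only, and it remains infinite and in NP if these are
  removed.
\<close>

section \<open>Transition systems on tapes\<close>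

type_synonym 'q trans = "'q \<Rightarrow> symbol list \<Rightarrow> ('q \<times> (symbol \<times> dir) list) set"

definition dstep :: "'q trans \<Rightarrow> 'q config \<Rightarrow> 'q config \<Rightarrow> bool" where
  "dstep \<delta> c c' \<longleftrightarrow>
     (\<exists>q' acts. (q', acts) \<in> \<delta> (fst c) (map scan (snd c)) \<and> c' = (q', map2 act acts (snd c)))"

definition accepting_from :: "'q trans \<Rightarrow> 'q set \<Rightarrow> 'q config \<Rightarrow> bool" where
  "accepting_from \<delta> F c \<longleftrightarrow>
     (\<exists>c'. (dstep \<delta>)\<^sup>*\<^sup>* c c' \<and> (\<nexists>c''. dstep \<delta> c' c'') \<and> fst c' \<in> F)"

definition bounded_from :: "'q trans \<Rightarrow> 'q config \<Rightarrow> nat \<Rightarrow> bool" where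
  "bounded_from \<delta> c t \<longleftrightarrow> (\<forall>n c'. (dstep \<delta> ^^ n) c c' \<longrightarrow> n \<le> t)"

text \<open>A bound on the number of nodes of the computation tree. Table entries that lead to the same
  configuration are counted separately, as the search below visits each of them.\<close>

inductive tree_bound :: "'q trans \<Rightarrow> 'q config \<Rightarrow> nat \<Rightarrow> bool" for \<delta> where
  tree_boundI: "(\<And>c'. dstep \<delta> c c' \<Longrightarrow> tree_bound \<delta> c' s) \<Longrightarrow>
     1 + card (\<delta> (fst c) (map scan (snd c))) * s \<le> s' \<Longrightarrow> tree_bound \<delta> c s'"

definition delta :: "'q tm \<Rightarrow> 'q trans" where
  "delta M q ss = {(q', acts). (q, ss, q', acts) \<in> table M}"

lemma step_eq_dstep: "step M = dstep (delta M)"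
  by (auto simp: step_def dstep_def delta_def fun_eq_iff)

lemma accepts_iff: "accepts M x \<longleftrightarrow> accepting_from (delta M) (accepting M) (init M x)"
  by (simp add: accepts_def accepting_from_def halted_def step_eq_dstep)

lemma halts_within_iff: "halts_within M x t \<longleftrightarrow> bounded_from (delta M) (init M x) t"
  by (simp add: halts_within_def bounded_from_def step_eq_dstep)

lemma accepting_from_unfold:
  "accepting_from \<delta> F c \<longleftrightarrow>
     ((\<nexists>c'. dstep \<delta> c c') \<and> fst c \<in> F) \<or> (\<exists>c'. dstep \<delta> c c' \<and> accepting_from \<delta> F c')"
  unfolding accepting_from_def by (blast elim: converse_rtranclpE intro: converse_rtranclp_into_rtranclp)

lemma accepting_from_step:
  assumes "\<And>c'. dstep \<delta> c c' \<longleftrightarrow> c' = d"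
  shows "accepting_from \<delta> F c \<longleftrightarrow> accepting_from \<delta> F d"
  by (subst accepting_from_unfold) (metis assms)

lemma bounded_from_Suc:
  assumes "\<And>c'. dstep \<delta> c c' \<Longrightarrow> bounded_from \<delta> c' t"
  shows "bounded_from \<delta> c (Suc t)"
  unfolding bounded_from_def
proof (intro allI impI)
  fix n c' assume "(dstep \<delta> ^^ n) c c'"
  then show "n \<le> Suc t"
    using assms relpowp_Suc_D2[of _ "dstep \<delta>" c c'] unfolding bounded_from_def
    by (cases n) (blast intro: Suc_leI le_imp_less_Suc)+
qed

lemma tree_bound_mono: "tree_bound \<delta> c s \<Longrightarrow> s \<le> s' \<Longrightarrow> tree_bound \<delta> c s'"
  by (erule tree_bound.cases) (blast intro: tree_boundI order_trans)

lemma tree_bound_step: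
  assumes "\<And>c'. dstep \<delta> c c' \<Longrightarrow> tree_bound \<delta> c' s"
    and "card (\<delta> (fst c) (map scan (snd c))) \<le> b"
  shows "tree_bound \<delta> c (1 + b * s)"
  using assms by (intro tree_boundI[of \<delta> c s]) auto

lemma tree_bound_of_bounded_from:
  assumes "bounded_from \<delta> c t" and "\<And>q ss. card (\<delta> q ss) \<le> b"
  shows "tree_bound \<delta> c ((b + 1) ^ t)"
  using assms(1)
proof (induction t arbitrary: c)
  case 0
  have "\<not> dstep \<delta> c c'" for c'
  proof
    assume "dstep \<delta> c c'"
    then have "(dstep \<delta> ^^ Suc 0) c c'" by auto
    with 0 show False unfolding bounded_from_def by fastforce
  qed
  then show ?case
    by (intro tree_boundI[of \<delta> c 0]) auto
next
  case (Suc t)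
  have "tree_bound \<delta> c (1 + b * (b + 1) ^ t)"
  proof (rule tree_bound_step)
    fix c' assume "dstep \<delta> c c'"
    then show "tree_bound \<delta> c' ((b + 1) ^ t)"
      using Suc.prems relpowp_Suc_I2[of "dstep \<delta>" c c'] unfolding bounded_from_def
      by (intro Suc.IH) (metis Suc_le_mono bounded_from_def)
  qed (use assms in auto)
  then show ?case by (rule tree_bound_mono) auto
qed

lemma dstep_unique:
  assumes "\<And>q ss. card (\<delta> q ss) \<le> 1" "\<And>q ss. finite (\<delta> q ss)" "dstep \<delta> c d" "dstep \<delta> c d'"
  shows "d = d'"
  using assms unfolding dstep_def
  by (metis (no_types, lifting) One_nat_def card_le_Suc0_iff_eq prod.inject)

lemma halting_config_unique:
  assumes "\<And>q ss. card (\<delta> q ss) \<le> 1" "\<And>q ss. finite (\<delta> q ss)"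
    and "(dstep \<delta> ^^ n) c d" "\<nexists>e. dstep \<delta> d e" "(dstep \<delta> ^^ n') c d'" "\<nexists>e. dstep \<delta> d' e"
  shows "d = d'"
  using assms(3,5)
proof (induction n arbitrary: c n')
  case 0
  then show ?case using assms(4) relpowp_Suc_D2[of _ "dstep \<delta>" d d'] by (cases n') auto
next
  case (Suc n)
  obtain e where e: "dstep \<delta> c e" "(dstep \<delta> ^^ n) e d" using relpowp_Suc_D2[OF Suc.prems(1)] by blast
  have "n' \<noteq> 0" using Suc.prems(2) assms(6) e(1) by (metis relpowp_0_E)
  then obtain m where m: "n' = Suc m" by (cases n') auto
  obtain e' where e': "dstep \<delta> c e'" "(dstep \<delta> ^^ m) e' d'"
    using relpowp_Suc_D2 Suc.prems(2) unfolding m by metis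
  show ?case using Suc.IH[OF e(2)] e'(2) dstep_unique[OF assms(1,2) e(1) e'(1)] by blast
qed

lemma bounded_from_halting_run:
  assumes "(dstep \<delta> ^^ n) c d" and "\<nexists>d'. dstep \<delta> d d'" and det: "\<And>q ss. card (\<delta> q ss) \<le> 1"
    and fin: "\<And>q ss. finite (\<delta> q ss)"
  shows "bounded_from \<delta> c n \<and> (\<forall>F. accepting_from \<delta> F c \<longleftrightarrow> fst d \<in> F)"
  using assms(1)
proof (induction n arbitrary: c)
  case 0
  have "bounded_from \<delta> c 0"
    unfolding bounded_from_def
  proof (intro allI impI)
    fix n c' assume "(dstep \<delta> ^^ n) c c'"
    then show "n \<le> 0" using 0 assms(2) relpowp_Suc_D2[of _ "dstep \<delta>" c c'] by (cases n) auto
  qed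
  with 0 show ?case using assms(2) by (subst accepting_from_unfold) auto
next
  case (Suc n)
  then obtain c' where c': "dstep \<delta> c c'" "(dstep \<delta> ^^ n) c' d" by (meson relpowp_Suc_D2)
  have uniq: "dstep \<delta> c e \<longleftrightarrow> e = c'" for e
    using dstep_unique[OF det fin _ c'(1)] c'(1) by blast
  show ?case
    using Suc.IH[OF c'(2)] accepting_from_step[of \<delta> c c', OF uniq] bounded_from_Suc[of \<delta> c n] uniq
    by auto
qed

definition all_move :: "dir \<Rightarrow> symbol list \<Rightarrow> (symbol \<times> dir) list" where
  "all_move d ss = map (\<lambda>s. (s, d)) ss"

definition heads_at :: "int \<Rightarrow> (int \<Rightarrow> symbol) list \<Rightarrow> tape list" where
  "heads_at i Ts = map (\<lambda>T. (i, T)) Ts"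

lemma length_all_move [simp]: "length (all_move d ss) = length ss"
  by (simp add: all_move_def)

lemma mem_all_move [simp]: "(a, e) \<in> set (all_move d ss) \<longleftrightarrow> a \<in> set ss \<and> e = d"
  by (auto simp: all_move_def)

lemma all_move_eq_map2:
  "map2 act (all_move d (map scan ts)) ts = map (\<lambda>(h, T). (move d h, T)) ts"
  unfolding all_move_def by (induction ts) (auto simp: fun_upd_idem)

lemma all_move_heads_at:
  "map2 act (all_move d (map scan (heads_at i Ts))) (heads_at i Ts) = heads_at (move d i) Ts"
  by (simp add: all_move_eq_map2) (simp add: heads_at_def)

definition word_at :: "int \<Rightarrow> word \<Rightarrow> int \<Rightarrow> symbol" where
  "word_at k x = (\<lambda>i. if k \<le> i \<and> i < k + int (length x) then Bit (x ! nat (i - k)) else Blank)"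

lemma word_at_Nil [simp]: "word_at k [] = (\<lambda>_. Blank)"
  by (auto simp: word_at_def)

lemma input_tape_eq: "input_tape x = (0, word_at 0 x)"
  by (simp add: input_tape_def word_at_def fun_eq_iff)

lemma init_eq:
  "init M x = (start M, heads_at 0 (word_at 0 x # replicate (tapes M - 1) (\<lambda>_. Blank)))"
  by (simp add: init_def input_tape_eq heads_at_def)

lemma word_at_Cons: "(word_at (i + 1) x)(i := Bit b) = word_at i (b # x)"
  by (auto simp: word_at_def fun_eq_iff nth_Cons' nat_diff_distrib' intro!: arg_cong[where f = "nth x"])

locale transition_system =
  fixes k :: nat and Q :: "'q :: countable set" and \<Sigma> :: "symbol set" and \<delta> :: "'q trans"
    and s :: 'q and F :: "'q set"
  assumes tapes_pos: "k \<ge> 1" and finite_states: "finite Q" and finite_symbols: "finite \<Sigma>"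
    and start_state: "s \<in> Q" and blank: "Blank \<in> \<Sigma>" and bits: "\<And>b. Bit b \<in> \<Sigma>"
    and closed: "\<And>q ss q' acts. q \<in> Q \<Longrightarrow> length ss = k \<Longrightarrow> set ss \<subseteq> \<Sigma> \<Longrightarrow> (q', acts) \<in> \<delta> q ss \<Longrightarrow>
        q' \<in> Q \<and> length acts = k \<and> fst ` set acts \<subseteq> \<Sigma>"
    and finite_trans: "\<And>q ss. finite (\<delta> q ss)"
begin

definition machine :: "nat tm" where
  "machine = \<lparr>tapes = k,
     table = {(to_nat q, ss, to_nat q', acts) | q ss q' acts.
                q \<in> Q \<and> length ss = k \<and> set ss \<subseteq> \<Sigma> \<and> (q', acts) \<in> \<delta> q ss},
     start = to_nat s, accepting = to_nat ` F\<rparr>"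

definition valid :: "'q config \<Rightarrow> bool" where
  "valid c \<longleftrightarrow> fst c \<in> Q \<and> length (snd c) = k \<and> (\<forall>t \<in> set (snd c). range (snd t) \<subseteq> \<Sigma>)"

definition encode :: "'q config \<Rightarrow> nat config" where
  "encode c = (to_nat (fst c), snd c)"

definition initial :: "word \<Rightarrow> 'q config" where
  "initial x = (s, heads_at 0 (word_at 0 x # replicate (k - 1) (\<lambda>_. Blank)))"

lemma well_formed_machine: "well_formed machine"
proof -
  let ?S = "{ss. set ss \<subseteq> \<Sigma> \<and> length ss = k}"
  have "table machine \<subseteq>
     (\<Union>q \<in> Q. \<Union>ss \<in> ?S. (\<lambda>(q', acts). (to_nat q, ss, to_nat q', acts)) ` \<delta> q ss)"
    by (force simp: machine_def)
  moreover have "finite \<dots>"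
    using finite_states finite_symbols finite_trans by (simp add: finite_lists_length_eq)
  ultimately have "finite (table machine)" by (rule finite_subset)
  then show ?thesis
    using tapes_pos closed by (fastforce simp: well_formed_def machine_def)
qed

lemma delta_machine:
  assumes "q \<in> Q" "length ss = k" "set ss \<subseteq> \<Sigma>"
  shows "delta machine (to_nat q) ss = (\<lambda>(q', acts). (to_nat q', acts)) ` \<delta> q ss"
  using assms by (auto simp: delta_def machine_def)

lemma deterministic_machine:
  assumes "\<And>q ss. card (\<delta> q ss) \<le> 1"
  shows "deterministic machine"
  using assms finite_trans
  unfolding deterministic_def machine_def
  by (auto simp: card_le_Suc0_iff_eq) blast+

lemma valid_scan:
  assumes "valid c"
  shows "fst c \<in> Q" "length (map scan (snd c)) = k" "set (map scan (snd c)) \<subseteq> \<Sigma>"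
  using assms by (fastforce simp: valid_def)+

lemma valid_dstep:
  assumes "valid c" "dstep \<delta> c c'"
  shows "valid c'"
proof -
  from assms(2) obtain q' acts where
    *: "(q', acts) \<in> \<delta> (fst c) (map scan (snd c))" "c' = (q', map2 act acts (snd c))"
    by (auto simp: dstep_def)
  have cl: "q' \<in> Q" "length acts = k" "fst ` set acts \<subseteq> \<Sigma>"
    using closed[OF valid_scan[OF assms(1)] *(1)] by auto
  have "range (snd (act a t)) \<subseteq> \<Sigma>" if "(a, t) \<in> set (zip acts (snd c))" for a t
  proof -
    have "a \<in> set acts" "t \<in> set (snd c)"
      using that by (auto dest: set_zip_leftD set_zip_rightD)
    then have "fst a \<in> \<Sigma>" "range (snd t) \<subseteq> \<Sigma>"
      using cl(3) assms(1) by (auto simp: valid_def)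
    then show ?thesis by (cases a; cases t) auto
  qed
  then have "\<forall>t \<in> set (map2 act acts (snd c)). range (snd t) \<subseteq> \<Sigma>"
    unfolding set_map ball_simps by (simp only: case_prod_beta) (metis prod.collapse)
  then show ?thesis
    using cl assms(1) unfolding valid_def *(2) by simp
qed

lemma valid_relpowp: "(dstep \<delta> ^^ n) c c' \<Longrightarrow> valid c \<Longrightarrow> valid c'"
  by (induction n arbitrary: c') (auto intro: valid_dstep)

lemma dstep_machine_iff:
  assumes "valid c"
  shows "dstep (delta machine) (encode c) d \<longleftrightarrow> (\<exists>c'. dstep \<delta> c c' \<and> d = encode c')"
  using delta_machine[OF valid_scan[OF assms]]
  by (auto simp: dstep_def encode_def image_iff) force+

lemma relpowp_machine_iff:
  assumes "valid c"
  shows "(dstep (delta machine) ^^ n) (encode c) d \<longleftrightarrow>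
           (\<exists>c'. (dstep \<delta> ^^ n) c c' \<and> valid c' \<and> d = encode c')"
proof (induction n arbitrary: d)
  case (Suc n)
  then show ?case
  proof (intro iffI, goal_cases)
    case 1
    then obtain e where "(dstep (delta machine) ^^ n) (encode c) e" "dstep (delta machine) e d" by auto
    moreover then obtain c' where "(dstep \<delta> ^^ n) c c'" "valid c'" "e = encode c'" using Suc by blast
    ultimately show ?case
      using dstep_machine_iff[of c' d] valid_dstep[of c'] relpowp_Suc_I by metis
  next
    case 2
    then obtain c' e where c': "d = encode c'" "valid c'"
      and e: "(dstep \<delta> ^^ n) c e" "dstep \<delta> e c'" by auto
    have "valid e" using valid_relpowp[OF e(1) assms] .
    then show ?case
      using e Suc[of "encode e"] dstep_machine_iff[of e d] c' relpowp_Suc_I by metis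
  qed
qed (use assms in auto)

lemma init_machine: "init machine x = encode (initial x)"
  by (simp add: init_eq encode_def initial_def machine_def)

lemma valid_initial: "valid (initial x)"
  using tapes_pos start_state blank bits
  by (auto simp: valid_def initial_def heads_at_def word_at_def)

lemma bounded_from_machine: "halts_within machine x t \<longleftrightarrow> bounded_from \<delta> (initial x) t"
  unfolding halts_within_iff bounded_from_def init_machine
proof -
  show "(\<forall>n c'. (dstep (delta machine) ^^ n) (encode (initial x)) c' \<longrightarrow> n \<le> t) \<longleftrightarrow>
        (\<forall>n c'. (dstep \<delta> ^^ n) (initial x) c' \<longrightarrow> n \<le> t)"
    unfolding relpowp_machine_iff[OF valid_initial] using valid_relpowp[OF _ valid_initial] by blast
qed

lemma accepts_machine: "accepts machine x \<longleftrightarrow> accepting_from \<delta> F (initial x)"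
proof -
  have halt: "(\<nexists>d. dstep (delta machine) (encode c) d) \<longleftrightarrow> (\<nexists>d. dstep \<delta> c d)" if "valid c" for c
    using dstep_machine_iff[OF that] by blast
  have reach: "(dstep (delta machine))\<^sup>*\<^sup>* (encode (initial x)) d \<longleftrightarrow>
      (\<exists>c. (dstep \<delta>)\<^sup>*\<^sup>* (initial x) c \<and> valid c \<and> d = encode c)" for d
    using relpowp_machine_iff[OF valid_initial, of _ x d]
    by (auto simp: rtranclp_power)
  have val: "valid c" if "(dstep \<delta>)\<^sup>*\<^sup>* (initial x) c" for c
    using that by (induction rule: rtranclp_induct) (auto intro: valid_initial valid_dstep)
  have acc: "fst (encode c) \<in> accepting machine \<longleftrightarrow> fst c \<in> F" for c
    by (auto simp: encode_def machine_def)
  show ?thesis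
    unfolding accepts_iff accepting_from_def init_machine reach
    using halt val acc by metis
qed

lemma tree_bound_machine:
  assumes "tree_bound \<delta> c n" "valid c"
  shows "tree_bound (delta machine) (encode c) n"
  using assms
proof (induction rule: tree_bound.induct)
  case (tree_boundI c s s')
  have "card (delta machine (to_nat (fst c)) (map scan (snd c))) = card (\<delta> (fst c) (map scan (snd c)))"
    unfolding delta_machine[OF valid_scan[OF tree_boundI.prems]]
    by (intro card_image) (auto simp: inj_on_def)
  then have "1 + card (delta machine (fst (encode c)) (map scan (snd (encode c)))) * s \<le> s'"
    using tree_boundI.hyps by (simp add: encode_def)
  moreover have "tree_bound (delta machine) d s" if "dstep (delta machine) (encode c) d" for d
    using that tree_boundI.IH valid_dstep[OF tree_boundI.prems]
    unfolding dstep_machine_iff[OF tree_boundI.prems] by blast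
  ultimately show ?case by (rule tree_bound.tree_boundI[rotated])
qed

end

definition states :: "'q tm \<Rightarrow> 'q set" where
  "states M = insert (start M) (\<Union>(q, ss, q', acts) \<in> table M. {q, q'})"

definition symbols :: "'q tm \<Rightarrow> symbol set" where
  "symbols M = {Blank, Bit True, Bit False} \<union> (\<Union>(q, ss, q', acts) \<in> table M. set ss \<union> fst ` set acts)"

lemma finite_tm_states: "well_formed M \<Longrightarrow> finite (states M)"
  by (auto simp: states_def well_formed_def)

lemma finite_tm_symbols: "well_formed M \<Longrightarrow> finite (symbols M)"
  by (auto simp: symbols_def well_formed_def)

lemma Blank_in_symbols [simp]: "Blank \<in> symbols M"
  and Bit_in_symbols [simp]: "Bit b \<in> symbols M"
  and start_in_states [simp]: "start M \<in> states M"
  by (cases b) (auto simp: symbols_def states_def)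

lemma delta_closed:
  assumes "well_formed M" "(q', acts) \<in> delta M q ss"
  shows "q' \<in> states M" "length acts = tapes M" "length ss = tapes M" "fst ` set acts \<subseteq> symbols M"
    "set ss \<subseteq> symbols M"
  using assms by (force simp: delta_def states_def symbols_def well_formed_def)+

lemma delta_symbols:
  assumes "well_formed M" "(q', acts) \<in> delta M q ss" "(a, d) \<in> set acts"
  shows "a \<in> symbols M"
  using delta_closed(4)[OF assms(1,2)] assms(3) by force

lemma delta_subset_table: "delta M q ss \<subseteq> snd ` snd ` table M"
  by (force simp: delta_def)

lemma finite_delta: "well_formed M \<Longrightarrow> finite (delta M q ss)"
  using delta_subset_table by (rule finite_subset) (simp add: well_formed_def)

section \<open>Removing short words from an NP set\<close>

datatype filter_state = Count nat | Return nat | Original nat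

instance filter_state :: countable
  by countable_datatype

definition filter_delta :: "nat tm \<Rightarrow> nat \<Rightarrow> filter_state trans" where
  "filter_delta M k q ss =
     (case q of
        Count i \<Rightarrow> if hd ss = Blank then {}
                  else if i < k then {(Count (Suc i), all_move Right ss)}
                  else {(Return k, all_move Stay ss)}
      | Return i \<Rightarrow> if i = 0 then {(Original (start M), all_move Stay ss)}
                   else {(Return (i - 1), all_move Left ss)}
      | Original p \<Rightarrow> (\<lambda>(q', acts). (Original q', acts)) ` delta M p ss)"

lemma dstep_move_iff:
  assumes "\<delta> q (map scan (heads_at i Ts)) = {(q', all_move d (map scan (heads_at i Ts)))}"
  shows "dstep \<delta> (q, heads_at i Ts) c \<longleftrightarrow> c = (q', heads_at (move d i) Ts)"
  using assms by (simp add: dstep_def all_move_heads_at)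

lemma hd_scan_heads_at [simp]: "hd (map scan (heads_at i (T # Ts))) = T i"
  by (simp add: heads_at_def)

lemma word_at_eq_Blank_iff [simp]:
  "word_at k x i = Blank \<longleftrightarrow> \<not> (k \<le> i \<and> i < k + int (length x))"
  by (auto simp: word_at_def)

lemma transition_system_filter:
  assumes "well_formed M"
  shows "transition_system (tapes M) (Count ` {..k} \<union> Return ` {..k} \<union> Original ` states M)
           (symbols M) (filter_delta M k) (Count 0)"
proof
  fix q ss q' acts
  assume "q \<in> Count ` {..k} \<union> Return ` {..k} \<union> Original ` states M" "length ss = tapes M"
    "set ss \<subseteq> symbols M" "(q', acts) \<in> filter_delta M k q ss"
  then show "q' \<in> Count ` {..k} \<union> Return ` {..k} \<union> Original ` states M \<and> length acts = tapes M \<and>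
      fst ` set acts \<subseteq> symbols M"
    using delta_closed[OF assms]
    by (auto simp: filter_delta_def delta_symbols[OF assms] split: if_splits)
next
  show "finite (filter_delta M k q ss)" for q ss
    using finite_delta[OF assms] by (auto simp: filter_delta_def split: filter_state.split)
qed (use assms in \<open>auto simp: finite_tm_states finite_tm_symbols well_formed_def\<close>)

lemma dstep_Original_iff:
  "dstep (filter_delta M k) (Original q, ts) c \<longleftrightarrow>
     (\<exists>c'. dstep (delta M) (q, ts) c' \<and> c = (Original (fst c'), snd c'))"
  by (force simp: dstep_def filter_delta_def)

lemma relpowp_Original_iff:
  "(dstep (filter_delta M k) ^^ n) (Original q, ts) c \<longleftrightarrow>
     (\<exists>c'. (dstep (delta M) ^^ n) (q, ts) c' \<and> c = (Original (fst c'), snd c'))"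
proof (induction n arbitrary: c)
  case (Suc n)
  have "(dstep (filter_delta M k) ^^ Suc n) (Original q, ts) c \<longleftrightarrow>
     (\<exists>c'. (dstep (delta M) ^^ n) (q, ts) c' \<and>
           dstep (filter_delta M k) (Original (fst c'), snd c') c)"
    unfolding relpowp.simps OO_def Suc by blast
  then show ?case
    unfolding relpowp.simps OO_def dstep_Original_iff prod.collapse by blast
qed auto

lemma bounded_from_Original:
  assumes "bounded_from (delta M) (q, ts) t"
  shows "bounded_from (filter_delta M k) (Original q, ts) t"
  using assms unfolding bounded_from_def relpowp_Original_iff by blast

lemma accepting_from_Original:
  "accepting_from (filter_delta M k) (Original ` F) (Original q, ts) \<longleftrightarrow>
     accepting_from (delta M) F (q, ts)"
proof -
  have "(\<nexists>d. dstep (filter_delta M k) (Original (fst c), snd c) d) \<longleftrightarrow> (\<nexists>d. dstep (delta M) c d)" for c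
    unfolding dstep_Original_iff prod.collapse by blast
  moreover have "Original p \<in> Original ` F \<longleftrightarrow> p \<in> F" for p by auto
  ultimately show ?thesis
    unfolding accepting_from_def rtranclp_power relpowp_Original_iff
    by (metis fst_conv)
qed

lemma filter_length_NTIME_machine:
  fixes M :: "nat tm"
  assumes wf: "well_formed M" and dec: "decides_in_time M A f"
  obtains M' :: "nat tm" where "well_formed M'"
    "decides_in_time M' {x \<in> A. length x > k} (\<lambda>n. f n + 2 * k + 2)"
proof -
  interpret S: transition_system "tapes M" "Count ` {..k} \<union> Return ` {..k} \<union> Original ` states M"
    "symbols M" "filter_delta M k" "Count 0" "Original ` accepting M"
    by (rule transition_system_filter[OF wf])
  let ?d = "filter_delta M k" and ?F = "Original ` accepting M"
  have main: "bounded_from ?d (S.initial x) (f (length x) + 2 * k + 2) \<and>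
     (accepting_from ?d ?F (S.initial x) \<longleftrightarrow> x \<in> A \<and> length x > k)" for x
  proof -
    define Ts where "Ts = word_at 0 x # replicate (tapes M - 1) (\<lambda>_. Blank)"
    have orig: "bounded_from ?d (Original (start M), heads_at 0 Ts) (f (length x))"
      "accepting_from ?d ?F (Original (start M), heads_at 0 Ts) \<longleftrightarrow> x \<in> A"
      using dec by (auto simp: decides_in_time_def halts_within_iff accepts_iff init_eq Ts_def
          accepting_from_Original intro!: bounded_from_Original)
    have ret: "bounded_from ?d (Return i, heads_at (int i) Ts) (f (length x) + 1 + i) \<and>
       (accepting_from ?d ?F (Return i, heads_at (int i) Ts) \<longleftrightarrow> x \<in> A)" for i
    proof (induction i)
      case 0
      have *: "dstep ?d (Return 0, heads_at 0 Ts) c \<longleftrightarrow> c = (Original (start M), heads_at 0 Ts)" for c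
        by (subst dstep_move_iff[where d = Stay]) (auto simp: filter_delta_def)
      then show ?case
        using orig bounded_from_Suc[of ?d "(Return 0, heads_at 0 Ts)" "f (length x)"] accepting_from_step[OF *]
        by auto
    next
      case (Suc i)
      have *: "dstep ?d (Return (Suc i), heads_at (int (Suc i)) Ts) c \<longleftrightarrow>
          c = (Return i, heads_at (int i) Ts)" for c
        by (subst dstep_move_iff[where d = Left]) (auto simp: filter_delta_def)
      then show ?case
        using Suc bounded_from_Suc[of ?d "(Return (Suc i), heads_at (int (Suc i)) Ts)" "f (length x) + 1 + i"]
          accepting_from_step[OF *] by auto
    qed
    have "i \<le> k \<Longrightarrow> i \<le> length x \<Longrightarrow>
       bounded_from ?d (Count i, heads_at (int i) Ts) (f (length x) + 2 + k + (k - i)) \<and>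
       (accepting_from ?d ?F (Count i, heads_at (int i) Ts) \<longleftrightarrow> x \<in> A \<and> length x > k)" for i
    proof (induction "k - i" arbitrary: i)
      case 0
      show ?case
      proof (cases "i = length x")
        case True
        then have "\<not> dstep ?d (Count i, heads_at (int i) Ts) c" for c
          by (simp add: dstep_def filter_delta_def Ts_def)
        moreover then have "bounded_from ?d (Count i, heads_at (int i) Ts) (Suc (f (length x) + k + 1))"
          by (intro bounded_from_Suc) auto
        ultimately show ?thesis
          using 0 True by (subst accepting_from_unfold) auto
      next
        case False
        with 0 have "i = k" by auto
        then have *: "dstep ?d (Count i, heads_at (int i) Ts) c \<longleftrightarrow> c = (Return k, heads_at (int k) Ts)" for c
          using 0 False by (subst dstep_move_iff[where d = Stay]) (auto simp: filter_delta_def Ts_def)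
        then show ?thesis
          using 0 False \<open>i = k\<close> ret[of k] accepting_from_step[OF *]
            bounded_from_Suc[of ?d "(Count i, heads_at (int i) Ts)" "f (length x) + 1 + k"] by auto
      qed
    next
      case (Suc j)
      show ?case
      proof (cases "i = length x")
        case True
        then have no: "\<not> dstep ?d (Count i, heads_at (int i) Ts) c" for c
          by (simp add: dstep_def filter_delta_def Ts_def)
        then have "bounded_from ?d (Count i, heads_at (int i) Ts) (Suc (f (length x) + k + 1 + (k - i)))"
          by (intro bounded_from_Suc) auto
        then show ?thesis
          using Suc True no by (subst accepting_from_unfold) auto
      next
        case False
        then have *: "dstep ?d (Count i, heads_at (int i) Ts) c \<longleftrightarrow>
             c = (Count (Suc i), heads_at (int (Suc i)) Ts)" for c
          using Suc.hyps(2) Suc.prems False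
          by (subst dstep_move_iff[where d = Right]) (auto simp: filter_delta_def Ts_def add.commute)
        have "bounded_from ?d (Count (Suc i), heads_at (int (Suc i)) Ts) (f (length x) + 2 + k + (k - Suc i)) \<and>
          (accepting_from ?d ?F (Count (Suc i), heads_at (int (Suc i)) Ts) \<longleftrightarrow> x \<in> A \<and> length x > k)"
          using Suc.hyps(2) Suc.prems False by (intro Suc.hyps(1)) auto
        moreover have "Suc (f (length x) + 2 + k + (k - Suc i)) = f (length x) + 2 + k + (k - i)"
          using Suc.hyps(2) by simp
        ultimately show ?thesis
          using accepting_from_step[OF *] * bounded_from_Suc[of ?d "(Count i, heads_at (int i) Ts)"
              "f (length x) + 2 + k + (k - Suc i)"] by (metis)
      qed
    qed
    from this[of 0] show ?thesis
      by (simp add: S.initial_def Ts_def mult_2 add_ac)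
  qed
  show thesis
    by (rule that[OF S.well_formed_machine])
       (use main in \<open>auto simp: decides_in_time_def S.bounded_from_machine S.accepts_machine\<close>)
qed

lemma filter_length_NP:
  assumes "A \<in> NP"
  shows "{x \<in> A. length x > k} \<in> NP"
proof -
  obtain c and M :: "nat tm" and f where M: "well_formed M" "decides_in_time M A f"
    and f: "(\<lambda>n. real (f n)) \<in> O(\<lambda>n. real (n ^ c))"
    using assms by (auto simp: NP_def NTIME_def)
  obtain M' :: "nat tm" where M': "well_formed M'"
    "decides_in_time M' {x \<in> A. length x > k} (\<lambda>n. f n + 2 * k + 2)"
    using filter_length_NTIME_machine[OF M] .
  have "(\<lambda>n. real (2 * k + 2)) \<in> O(\<lambda>n. real (n ^ c))"
    by (rule bigoI[of _ "real (2 * k + 2)"], rule eventually_sequentiallyI[of 1])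
       (simp add: one_le_power)
  with f have "(\<lambda>n. real (f n) + real (2 * k + 2)) \<in> O(\<lambda>n. real (n ^ c))"
    by (rule sum_in_bigo)
  then have "(\<lambda>n. real (f n + 2 * k + 2)) \<in> O(\<lambda>n. real (n ^ c))"
    by (simp add: algebra_simps)
  with M' have "{x \<in> A. length x > k} \<in> NTIME (\<lambda>n. n ^ c)" unfolding NTIME_def by blast
  then show ?thesis by (auto simp: NP_def)
qed

section \<open>Deterministic search of a computation tree\<close>

text \<open>
  The simulation keeps on an extra tape the stack of table entries applied so far. As an entry
  contains the old state and the overwritten symbols, popping it suffices to undo the step. State
  \<open>Try q i\<close> tries in turn the entries from index i on.
\<close>

datatype search_state = Try nat nat | Pop | Restore nat | Accept

instance search_state :: countable
  by countable_datatype

fun opposite :: "dir \<Rightarrow> dir" where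
  "opposite Left = Right"
| "opposite Stay = Stay"
| "opposite Right = Left"

definition search_delta ::
  "nat tm \<Rightarrow> (nat \<times> symbol list \<times> nat \<times> (symbol \<times> dir) list) list \<Rightarrow> search_state trans" where
  "search_delta M es q us =
     (case q of
        Try p i \<Rightarrow>
          if i < length es then
            (case es ! i of (p', ss, q', acts) \<Rightarrow>
               if p' = p \<and> ss = butlast us then {(Try q' 0, acts @ [(Aux i, Right)])}
               else {(Try p (Suc i), all_move Stay us)})
          else if delta M p (butlast us) = {} \<and> p \<in> accepting M then {(Accept, all_move Stay us)}
          else {(Pop, all_move Stay (butlast us) @ [(Blank, Left)])}
      | Pop \<Rightarrow>
          (case last us of
             Aux i \<Rightarrow>
               if i < length es then
                 (case es ! i of (p, ss, q', acts) \<Rightarrow>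
                    {(Restore i, map2 (\<lambda>s a. (s, opposite (snd a))) (butlast us) acts @ [(Blank, Stay)])})
               else {}
           | _ \<Rightarrow> {})
      | Restore i \<Rightarrow>
          if i < length es then
            (case es ! i of (p, ss, q', acts) \<Rightarrow>
               {(Try p (Suc i), all_move Stay ss @ [(Blank, Stay)])})
          else {}
      | Accept \<Rightarrow> {})"

lemma card_search_delta: "finite (search_delta M es q us)" "card (search_delta M es q us) \<le> 1"
  by (auto simp: search_delta_def split: search_state.split symbol.split prod.split)

definition search_states where
  "search_states M es = (\<Union>q \<in> states M. Try q ` {..length es}) \<union> Restore ` {..<length es} \<union> {Pop, Accept}"

definition search_symbols where
  "search_symbols M es = symbols M \<union> Aux ` {..<length es}"

lemma search_states_simps [simp]:
  "Try p i \<in> search_states M es \<longleftrightarrow> p \<in> states M \<and> i \<le> length es"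
  "Restore i \<in> search_states M es \<longleftrightarrow> i < length es"
  "Pop \<in> search_states M es" "Accept \<in> search_states M es"
  by (auto simp: search_states_def)

lemma transition_system_search:
  assumes wf: "well_formed M" and es: "set es = table M"
  shows "transition_system (Suc (tapes M)) (search_states M es)
           (search_symbols M es) (search_delta M es) (Try (start M) 0)"
  (is "transition_system _ ?Q ?S _ _")
proof
  show "finite ?Q" "finite ?S"
    using wf finite_tm_states[OF wf] finite_tm_symbols[OF wf]
    by (auto simp: search_states_def search_symbols_def well_formed_def)
  show "Try (start M) 0 \<in> ?Q" "Blank \<in> ?S" "Bit b \<in> ?S" for b
    by (auto simp: search_states_def search_symbols_def)
  show "finite (search_delta M es q us)" for q us by (rule card_search_delta)
  fix q us q' acts
  assume q: "q \<in> ?Q" and us: "length us = Suc (tapes M)" "set us \<subseteq> ?S"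
    and *: "(q', acts) \<in> search_delta M es q us"
  have but: "s \<in> ?S" if "s \<in> set (butlast us)" for s using us(2) that in_set_butlastD by fastforce
  have ent: "length ss = tapes M" "length as = tapes M" "set ss \<subseteq> ?S" "fst ` set as \<subseteq> ?S"
    "p \<in> states M" "p' \<in> states M"
    if "i < length es" "es ! i = (p, ss, p', as)" for i p ss p' as
  proof -
    have t: "(p, ss, p', as) \<in> table M" using that es by (metis nth_mem)
    then have d: "(p', as) \<in> delta M p ss" by (simp add: delta_def)
    show "length ss = tapes M" "length as = tapes M" "set ss \<subseteq> ?S" "fst ` set as \<subseteq> ?S" "p' \<in> states M"
      using delta_closed[OF wf d] by (auto simp: search_symbols_def)
    show "p \<in> states M" using t by (force simp: states_def)
  qed
  have blank: "Blank \<in> ?S" by (simp add: search_symbols_def)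
  show "q' \<in> ?Q \<and> length acts = Suc (tapes M) \<and> fst ` set acts \<subseteq> ?S"
  proof (cases q)
    case (Try p i)
    show ?thesis
    proof (cases "i < length es")
      case True
      obtain p' ss r as where e: "es ! i = (p', ss, r, as)" by (metis prod_cases4)
      show ?thesis
        using * ent[OF True e] us q True Try e
        by (auto simp: search_delta_def search_symbols_def split: if_splits)
    next
      case False
      then show ?thesis
        using * us but blank Try
        by (auto simp: search_delta_def split: if_splits)
    qed
  next
    case Pop
    then obtain i where i: "last us = Aux i" "i < length es"
      using * by (auto simp: search_delta_def split: symbol.splits if_splits)
    obtain p' ss r as where e: "es ! i = (p', ss, r, as)" by (metis prod_cases4)
    show ?thesis
      using * ent[OF i(2) e] us i Pop e but blank
      by (auto simp: search_delta_def dest!: set_zip_leftD)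
  next
    case (Restore i)
    then have i: "i < length es" using * by (auto simp: search_delta_def split: if_splits)
    obtain p' ss r as where e: "es ! i = (p', ss, r, as)" by (metis prod_cases4)
    show ?thesis
      using * ent[OF i e] us i Restore e blank
      by (auto simp: search_delta_def)
  next
    case Accept
    then show ?thesis using * by (simp add: search_delta_def)
  qed
qed (use wf in auto)

definition apply_entry where
  "apply_entry e ts = (case e of (p, ss, q, acts) \<Rightarrow> (q, map2 act acts ts))"

definition applicable where
  "applicable c e \<longleftrightarrow> fst e = fst c \<and> fst (snd e) = map scan (snd c)"

lemma dstep_iff_entry:
  assumes "set es = table M"
  shows "dstep (delta M) c c' \<longleftrightarrow> (\<exists>e \<in> set es. applicable c e \<and> c' = apply_entry e (snd c))"
  by (force simp: assms dstep_def delta_def applicable_def apply_entry_def)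

lemma undo_actions:
  assumes "length acts = length ts"
  shows "map2 act (all_move Stay (map scan ts))
           (map2 act (map2 (\<lambda>s a. (s, opposite (snd a))) (map scan (map2 act acts ts)) acts)
              (map2 act acts ts)) = ts"
  using assms
proof (induction acts ts rule: list_induct2)
  case (Cons a acts t ts)
  obtain w d h T where "a = (w, d)" "t = (h, T)" by (cases a; cases t)
  then show ?case using Cons by (cases d) (auto simp: all_move_def fun_upd_idem)
qed (simp add: all_move_def)

lemma relpowp_trans: "(R ^^ m) a b \<Longrightarrow> (R ^^ n) b c \<Longrightarrow> (R ^^ (m + n)) a c"
  by (auto simp: relpowp_add)

definition search_reaches where
  "search_reaches M es N c P t h H \<longleftrightarrow>
     (\<exists>n \<le> N. \<exists>d. (dstep (search_delta M es) ^^ n) c d \<and>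
        (if P then fst d = Accept else d = (Pop, t @ [(h - 1, H)])))"

lemma search_reaches_step:
  assumes "dstep (search_delta M es) c c'" "search_reaches M es N c' P t h H" "Suc N \<le> N'"
  shows "search_reaches M es N' c P t h H"
  using assms relpowp_Suc_I2 unfolding search_reaches_def by (meson Suc_le_mono le_trans)

lemma search_reaches_mono:
  "search_reaches M es N c P t h H \<Longrightarrow> N \<le> N' \<Longrightarrow> search_reaches M es N' c P t h H"
  unfolding search_reaches_def by (meson le_trans)

context
  fixes M :: "nat tm" and es
  assumes wf: "well_formed M" and es: "set es = table M" "distinct es"
begin

lemma search_entries:
  fixes h :: int and H :: "int \<Rightarrow> symbol"
  assumes len: "length ts = tapes M" and blank: "\<forall>j \<ge> h. H j = Blank"
    and child: "\<And>e h H. e \<in> set es \<Longrightarrow> applicable (q, ts) e \<Longrightarrow> \<forall>j \<ge> h. H j = Blank \<Longrightarrow>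
      search_reaches M es N (Try (fst (apply_entry e ts)) 0, snd (apply_entry e ts) @ [(h, H)])
        (accepting_from (delta M) (accepting M) (apply_entry e ts)) (snd (apply_entry e ts)) h H"
    and split: "es = pre @ post"
  shows "search_reaches M es (length post + 1 + length (filter (applicable (q, ts)) post) * (N + 2))
     (Try q (length pre), ts @ [(h, H)])
     (delta M q (map scan ts) = {} \<and> q \<in> accepting M \<or>
      (\<exists>e \<in> set post. applicable (q, ts) e \<and> accepting_from (delta M) (accepting M) (apply_entry e ts)))
     ts h H"
  using split
proof (induction post arbitrary: pre)
  case Nil
  have Hh: "H(h := Blank) = H" using blank by auto
  show ?case
  proof (cases "delta M q (map scan ts) = {} \<and> q \<in> accepting M")
    case True
    have "dstep (search_delta M es) (Try q (length pre), ts @ [(h, H)])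
        (Accept, map2 act (all_move Stay (map scan (ts @ [(h, H)]))) (ts @ [(h, H)]))"
      using True Nil by (auto simp: dstep_def search_delta_def)
    then show ?thesis using True
      unfolding search_reaches_def by (intro exI[of _ "Suc 0"]) auto
  next
    case False
    have "dstep (search_delta M es) (Try q (length pre), ts @ [(h, H)]) (Pop, ts @ [(h - 1, H)])"
      using False Nil Hh all_move_eq_map2[of Stay ts]
      by (auto simp: dstep_def search_delta_def zip_append all_move_def)
    then show ?thesis using False
      unfolding search_reaches_def by (intro exI[of _ "Suc 0"]) auto
  qed
next
  case (Cons e post)
  obtain p ss q' acts where e: "e = (p, ss, q', acts)" by (metis prod_cases4)
  have nth: "length pre < length es" "es ! length pre = (p, ss, q', acts)"
    using Cons.prems e by auto
  let ?B = "length post + 1 + length (filter (applicable (q, ts)) post) * (N + 2)"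
  let ?P = "delta M q (map scan ts) = {} \<and> q \<in> accepting M \<or>
      (\<exists>e \<in> set post. applicable (q, ts) e \<and> accepting_from (delta M) (accepting M) (apply_entry e ts))"
  have IH: "search_reaches M es ?B (Try q (Suc (length pre)), ts @ [(h, H)]) ?P ts h H"
    using Cons.IH[of "pre @ [e]"] Cons.prems by simp
  show ?case
  proof (cases "applicable (q, ts) e")
    case False
    have "dstep (search_delta M es) (Try q (length pre), ts @ [(h, H)])
        (Try q (Suc (length pre)), ts @ [(h, H)])"
      using False nth e all_move_eq_map2[of Stay "ts @ [(h, H)]"]
      by (auto simp: dstep_def search_delta_def applicable_def)
    from search_reaches_step[OF this IH] show ?thesis
      using False by simp
  next
    case True
    define ts' where "ts' = map2 act acts ts"
    have "(p, ss, q', acts) \<in> table M" using Cons.prems e es(1) by auto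
    then have acts: "length acts = length ts" "length ts' = length ts"
      using wf len unfolding well_formed_def ts'_def by auto
    have e_app: "p = q" "ss = map scan ts" "apply_entry e ts = (q', ts')"
      using True by (auto simp: e applicable_def apply_entry_def ts'_def)
    let ?H = "H(h := Aux (length pre))"
    have push: "dstep (search_delta M es) (Try q (length pre), ts @ [(h, H)]) (Try q' 0, ts' @ [(h + 1, ?H)])"
      using nth e_app acts by (auto simp: dstep_def search_delta_def ts'_def)
    have "search_reaches M es N (Try q' 0, ts' @ [(h + 1, ?H)])
        (accepting_from (delta M) (accepting M) (q', ts')) ts' (h + 1) ?H"
      using child[of e "h + 1" ?H] Cons.prems True blank e_app by auto
    then obtain n d where n: "n \<le> N" "(dstep (search_delta M es) ^^ n) (Try q' 0, ts' @ [(h + 1, ?H)]) d"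
      and d: "if accepting_from (delta M) (accepting M) (q', ts') then fst d = Accept
        else d = (Pop, ts' @ [(h, ?H)])"
      unfolding search_reaches_def add_diff_cancel_right' by blast
    have pushn: "(dstep (search_delta M es) ^^ Suc n) (Try q (length pre), ts @ [(h, H)]) d"
      using relpowp_Suc_I2[OF push n(2)] .
    show ?thesis
    proof (cases "accepting_from (delta M) (accepting M) (q', ts')")
      case acc: True
      then show ?thesis
        using pushn d n(1) True e_app unfolding search_reaches_def
        by (intro exI[of _ "Suc n"] conjI exI[of _ d]) (auto simp del: relpowp.simps)
    next
      case nacc: False
      have Hh: "?H(h := Blank) = H" "H(h := Blank) = H" using blank by auto
      define ts'' where "ts'' = map2 act (map2 (\<lambda>s a. (s, opposite (snd a))) (map scan ts') acts) ts'"
      have pop: "dstep (search_delta M es) (Pop, ts' @ [(h, ?H)]) (Restore (length pre), ts'' @ [(h, H)])"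
        using nth acts Hh by (auto simp: dstep_def search_delta_def ts''_def)
      have "dstep (search_delta M es) (Restore (length pre), ts'' @ [(h, H)])
          (Try p (Suc (length pre)), map2 act (all_move Stay ss) ts'' @ [(h, H)])"
        using nth acts Hh e_app by (auto simp: dstep_def search_delta_def ts''_def)
      moreover have "map2 act (all_move Stay ss) ts'' = ts"
        using undo_actions[OF acts(1)] by (simp add: ts''_def ts'_def e_app)
      ultimately have restore: "dstep (search_delta M es) (Restore (length pre), ts'' @ [(h, H)])
          (Try q (Suc (length pre)), ts @ [(h, H)])"
        using e_app by simp
      have d': "d = (Pop, ts' @ [(h, ?H)])" using d nacc by simp
      have run: "(dstep (search_delta M es) ^^ (Suc n + 2)) (Try q (length pre), ts @ [(h, H)])
          (Try q (Suc (length pre)), ts @ [(h, H)])"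
        using relpowp_Suc_I[OF relpowp_Suc_I[OF pushn[unfolded d']] restore] pop by (simp only: add_2_eq_Suc')
      obtain m d' where m: "m \<le> ?B"
          "(dstep (search_delta M es) ^^ m) (Try q (Suc (length pre)), ts @ [(h, H)]) d'"
        and d': "if ?P then fst d' = Accept else d' = (Pop, ts @ [(h - 1, H)])"
        using IH unfolding search_reaches_def by blast
      have "(dstep (search_delta M es) ^^ (Suc n + 2 + m)) (Try q (length pre), ts @ [(h, H)]) d'"
        using relpowp_trans[OF run m(2)] .
      moreover have "Suc n + 2 + m \<le>
          length (e # post) + 1 + length (filter (applicable (q, ts)) (e # post)) * (N + 2)"
        using m(1) n(1) True by simp
      ultimately show ?thesis
        using d' nacc e_app unfolding search_reaches_def
        by (intro exI[of _ "Suc n + 2 + m"] conjI exI[of _ d']) auto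
    qed
  qed
qed

lemma search_tree:
  assumes "tree_bound (delta M) c s" "length (snd c) = tapes M" "\<forall>j \<ge> h. H j = Blank"
  shows "search_reaches M es ((3 * length es + 1) * s) (Try (fst c) 0, snd c @ [(h, H)])
     (accepting_from (delta M) (accepting M) c) (snd c) h H"
  using assms
proof (induction arbitrary: h H rule: tree_bound.induct)
  case (tree_boundI c s s')
  obtain q ts where c: "c = (q, ts)" by (cases c)
  let ?K = "3 * length es + 1"
  have len: "length (snd (apply_entry e ts)) = tapes M" if "e \<in> set es" for e
    using that es wf tree_boundI.prems by (auto simp: apply_entry_def well_formed_def c)
  have "search_reaches M es (length es + 1 + length (filter (applicable (q, ts)) es) * (?K * s + 2))
     (Try q 0, ts @ [(h, H)])
     (delta M q (map scan ts) = {} \<and> q \<in> accepting M \<or>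
      (\<exists>e \<in> set es. applicable (q, ts) e \<and> accepting_from (delta M) (accepting M) (apply_entry e ts)))
     ts h H"
  proof (rule search_entries[where pre = "[]" and post = es, unfolded list.size(3)])
    fix e and h :: int and H assume "e \<in> set es" "applicable (q, ts) e" "\<forall>j \<ge> h. H j = Blank"
    moreover then have "dstep (delta M) c (apply_entry e ts)"
      unfolding dstep_iff_entry[OF es(1)] by (auto simp: c)
    ultimately show "search_reaches M es (?K * s)
        (Try (fst (apply_entry e ts)) 0, snd (apply_entry e ts) @ [(h, H)])
        (accepting_from (delta M) (accepting M) (apply_entry e ts)) (snd (apply_entry e ts)) h H"
      using tree_boundI.IH len by blast
  qed (use tree_boundI.prems c in auto)
  moreover have "delta M q (map scan ts) = {} \<and> q \<in> accepting M \<or>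
      (\<exists>e \<in> set es. applicable (q, ts) e \<and> accepting_from (delta M) (accepting M) (apply_entry e ts))
      \<longleftrightarrow> accepting_from (delta M) (accepting M) c"
  proof -
    have "(\<nexists>c'. dstep (delta M) c c') \<longleftrightarrow> delta M q (map scan ts) = {}"
      by (auto simp: dstep_def c)
    then show ?thesis
      unfolding accepting_from_unfold[of _ _ c] unfolding dstep_iff_entry[OF es(1)]
      by (simp only: c fst_conv snd_conv) blast
  qed
  moreover have "length es + 1 + length (filter (applicable (q, ts)) es) * (?K * s + 2) \<le> ?K * s'"
  proof -
    let ?n = "length (filter (applicable (q, ts)) es)"
    have "?n = card (set (filter (applicable (q, ts)) es))"
      using es(2) by (simp only: distinct_card distinct_filter)
    also have "set (filter (applicable (q, ts)) es) = (\<lambda>r. (q, map scan ts, r)) ` delta M q (map scan ts)"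
      using es(1) by (force simp: applicable_def delta_def)
    also have "card \<dots> = card (delta M q (map scan ts))"
      by (intro card_image) (auto simp: inj_on_def)
    finally have "1 + ?n * s \<le> s'" using tree_boundI.hyps c by simp
    then have "?K * (1 + ?n * s) \<le> ?K * s'" by (rule mult_le_mono2)
    moreover have "length es + 1 + n * (?K * s + 2) \<le> ?K * (1 + n * s)" if "n \<le> length es" for n
      using that by (simp add: algebra_simps)
    ultimately show ?thesis using length_filter_le order_trans by blast
  qed
  ultimately show ?case
    by (simp only: c fst_conv snd_conv) (rule search_reaches_mono)
qed

end

lemma search_machine:
  fixes M :: "nat tm"
  assumes wf: "well_formed M"
  obtains M' :: "nat tm" and K where "well_formed M'" "deterministic M'"
    "\<And>x s. tree_bound (delta M) (init M x) s \<Longrightarrow>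
       halts_within M' x (K * s) \<and> (accepts M' x \<longleftrightarrow> accepts M x)"
proof -
  obtain es where es: "set es = table M" "distinct es"
    using finite_distinct_list[of "table M"] wf unfolding well_formed_def by blast
  interpret S: transition_system "Suc (tapes M)" "search_states M es" "search_symbols M es"
    "search_delta M es" "Try (start M) 0" "{Accept}"
    by (rule transition_system_search[OF wf es(1)])
  have "halts_within S.machine x ((3 * length es + 1) * s) \<and> (accepts S.machine x \<longleftrightarrow> accepts M x)"
    if tb: "tree_bound (delta M) (init M x) s" for x s
  proof -
    have pos: "tapes M \<ge> 1" using wf by (simp add: well_formed_def)
    have ini: "S.initial x = (Try (fst (init M x)) 0, snd (init M x) @ [(0, \<lambda>_. Blank)])"
      unfolding S.initial_def init_eq using pos
      by (cases "tapes M") (auto simp: heads_at_def replicate_append_same)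
    obtain n d where n: "n \<le> (3 * length es + 1) * s" "(dstep (search_delta M es) ^^ n) (S.initial x) d"
      and d: "if accepts M x then fst d = Accept else d = (Pop, snd (init M x) @ [(-1, \<lambda>_. Blank)])"
    proof -
      have "length (snd (init M x)) = tapes M" using pos by (simp add: init_def)
      from search_tree[OF wf es tb this, of 0 "\<lambda>_. Blank"] show ?thesis
        using that unfolding search_reaches_def ini accepts_iff diff_0 by blast
    qed
    have "\<nexists>d'. dstep (search_delta M es) d d'"
      using d by (auto simp: dstep_def search_delta_def split: if_splits)
    from bounded_from_halting_run[OF n(2) this card_search_delta(2,1)]
    have "bounded_from (search_delta M es) (S.initial x) n"
      "accepting_from (search_delta M es) {Accept} (S.initial x) \<longleftrightarrow> fst d \<in> {Accept}" by auto
    then show ?thesis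
      using d n(1) unfolding S.bounded_from_machine S.accepts_machine
      by (auto simp: bounded_from_def split: if_splits intro: order_trans)
  qed
  then show thesis
    using that S.well_formed_machine S.deterministic_machine[OF card_search_delta(2)] by blast
qed

lemma exp_poly_bigo:
  fixes f :: "nat \<Rightarrow> nat"
  assumes "(\<lambda>n. real (f n)) \<in> O(\<lambda>n. real (n ^ c))"
  shows "(\<lambda>n. real (K * b ^ f n)) \<in> O(\<lambda>n. real (2 ^ (n ^ Suc c)))"
proof -
  obtain C where C: "C > 0" "eventually (\<lambda>n. real (f n) \<le> C * real (n ^ c)) sequentially"
    using assms by (auto elim!: landau_o.bigE)
  obtain m :: nat where m: "real m \<ge> real b * C" using real_arch_simple by blast
  have "eventually (\<lambda>n. n \<ge> m) sequentially" by (rule eventually_ge_at_top)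
  with C(2) have "eventually (\<lambda>n. K * b ^ f n \<le> K * 2 ^ (n ^ Suc c)) sequentially"
  proof eventually_elim
    case (elim n)
    have "real (b * f n) \<le> real b * (C * real (n ^ c))"
      using elim(1) by (simp add: mult_left_mono)
    also have "\<dots> \<le> real m * real (n ^ c)" using m by (simp add: mult_right_mono flip: mult.assoc)
    also have "\<dots> \<le> real n * real (n ^ c)" using elim(2) by (intro mult_right_mono) auto
    finally have le: "b * f n \<le> n ^ Suc c"
      by (metis of_nat_le_iff of_nat_mult power_Suc)
    have "b ^ f n \<le> (2 ^ b) ^ f n" by (intro power_mono) (auto simp: less_imp_le)
    also have "\<dots> = 2 ^ (b * f n)" by (simp add: power_mult)
    also have "\<dots> \<le> 2 ^ (n ^ Suc c)" using le by (intro power_increasing) auto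
    finally show ?case by simp
  qed
  then have "eventually (\<lambda>n. real (K * b ^ f n) \<le> real K * real (2 ^ (n ^ Suc c))) sequentially"
    by eventually_elim (metis of_nat_le_iff of_nat_mult)
  then show ?thesis by (intro bigoI[of _ "real K"]) (auto elim!: eventually_mono)
qed

lemma NP_subset_EXP: "NP \<subseteq> EXP"
proof
  fix A assume "A \<in> NP"
  then obtain c and M :: "nat tm" and f where M: "well_formed M" "decides_in_time M A f"
    and f: "(\<lambda>n. real (f n)) \<in> O(\<lambda>n. real (n ^ c))"
    by (auto simp: NP_def NTIME_def)
  obtain M' :: "nat tm" and K where M': "well_formed M'" "deterministic M'"
    "\<And>x s. tree_bound (delta M) (init M x) s \<Longrightarrow>
       halts_within M' x (K * s) \<and> (accepts M' x \<longleftrightarrow> accepts M x)"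
    by (rule search_machine[OF M(1)]) blast
  let ?b = "card (snd ` snd ` table M)"
  have "tree_bound (delta M) (init M x) ((?b + 1) ^ f (length x))" for x
    using M by (intro tree_bound_of_bounded_from)
      (auto simp: decides_in_time_def halts_within_iff well_formed_def intro!: card_mono delta_subset_table)
  then have "decides_in_time M' A (\<lambda>n. K * (?b + 1) ^ f n)"
    using M' M(2) by (auto simp: decides_in_time_def)
  with M'(1,2) exp_poly_bigo[OF f, of K "?b + 1"] have "A \<in> DTIME (\<lambda>n. 2 ^ (n ^ Suc c))"
    unfolding DTIME_def by blast
  then show "A \<in> EXP" unfolding EXP_def by blast
qed

section \<open>A binary counter as a clock\<close>

text \<open>
  In mode \<open>True\<close> a carry is propagated to the right from the least significant bit; in mode
  \<open>False\<close> the head returns to that bit. The counter stops when the carry leaves the last bit.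
\<close>

fun clock_action :: "bool \<Rightarrow> symbol \<Rightarrow> (bool \<times> symbol \<times> dir) option" where
  "clock_action True (Bit True) = Some (True, Bit False, Right)"
| "clock_action True (Bit False) = Some (False, Bit True, Left)"
| "clock_action False (Bit b) = Some (False, Bit b, Left)"
| "clock_action False Blank = Some (True, Blank, Right)"
| "clock_action _ _ = None"

definition clock_value :: "nat \<Rightarrow> (int \<Rightarrow> symbol) \<Rightarrow> nat" where
  "clock_value n T = (\<Sum>i<n. if T (int i) = Bit True then 2 ^ i else 0)"

definition clock_ok :: "nat \<Rightarrow> bool \<Rightarrow> tape \<Rightarrow> bool" where
  "clock_ok n m t \<longleftrightarrow>
     (\<forall>i. (0 \<le> i \<and> i < int n \<longrightarrow> (\<exists>b. snd t i = Bit b)) \<and>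
          (\<not> (0 \<le> i \<and> i < int n) \<longrightarrow> snd t i = Blank)) \<and>
     (if m then 0 \<le> fst t \<and> fst t \<le> int n \<and> clock_value n (snd t) + 2 ^ nat (fst t) \<le> 2 ^ n
      else -1 \<le> fst t \<and> fst t < int n)"

definition clock_lower :: "nat \<Rightarrow> bool \<Rightarrow> tape \<Rightarrow> nat" where
  "clock_lower n m t = 2 ^ n - (clock_value n (snd t) + (if m then 2 ^ nat (fst t) else 1))"

definition clock_upper :: "nat \<Rightarrow> bool \<Rightarrow> tape \<Rightarrow> nat" where
  "clock_upper n m t =
     (if m then (2 ^ n - (clock_value n (snd t) + 2 ^ nat (fst t))) * (2 * n + 4) + (n - nat (fst t))
      else (2 ^ n - (clock_value n (snd t) + 1)) * (2 * n + 4) + n + nat (fst t + 2))"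

lemma clock_value_upd:
  assumes "i < n"
  shows "clock_value n (T(int i := s)) + (if T (int i) = Bit True then 2 ^ i else 0) =
         clock_value n T + (if s = Bit True then 2 ^ i else 0)"
proof -
  have split: "clock_value n T' = (if T' (int i) = Bit True then 2 ^ i else 0) +
      (\<Sum>j \<in> {..<n} - {i}. if T' (int j) = Bit True then 2 ^ j else 0)" for T'
    using assms unfolding clock_value_def by (subst sum.remove[of _ i]) auto
  have "(\<Sum>j \<in> {..<n} - {i}. if (T(int i := s)) (int j) = Bit True then 2 ^ j else (0::nat)) =
      (\<Sum>j \<in> {..<n} - {i}. if T (int j) = Bit True then 2 ^ j else 0)"
    by (intro sum.cong) auto
  then show ?thesis by (simp add: split[of T] split[of "T(int i := s)"])
qed

lemma clock_value_less: "clock_value n T < 2 ^ n"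
proof -
  have "clock_value n T \<le> (\<Sum>i<n. 2 ^ i)" unfolding clock_value_def by (intro sum_mono) auto
  also have "\<dots> < 2 ^ n" by (induction n) auto
  finally show ?thesis .
qed

lemma clock_ok_cell: "clock_ok n m (h, T) \<Longrightarrow> 0 \<le> i \<Longrightarrow> i < int n \<Longrightarrow> \<exists>b. T i = Bit b"
  unfolding clock_ok_def by (metis snd_conv)

lemma clock_step:
  assumes ok: "clock_ok n m t" and a: "clock_action m (scan t) = Some (m', a)"
  shows "clock_ok n m' (act a t)" "clock_upper n m' (act a t) < clock_upper n m t"
    "clock_lower n m t \<le> clock_lower n m' (act a t) + 1"
proof -
  obtain h T where t: "t = (h, T)" by (cases t)
  note less = clock_value_less[of n]
  have sym: "0 \<le> h \<and> h < int n" if "T h = Bit b" for b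
    using ok that unfolding clock_ok_def t by (metis snd_conv symbol.distinct(1))
  have "clock_ok n m' (act a t) \<and> clock_upper n m' (act a t) < clock_upper n m t \<and>
    clock_lower n m t \<le> clock_lower n m' (act a t) + 1"
  proof (cases "T h")
    case Blank
    then have *: "m = False" "m' = True" "a = (Blank, Right)" using a by (cases m; simp add: t)+
    have h: "h = -1"
    proof (rule ccontr)
      assume "h \<noteq> -1"
      then have "0 \<le> h \<and> h < int n" using ok by (auto simp: clock_ok_def t *)
      then show False using clock_ok_cell[of n m h T h] ok Blank by (auto simp: t)
    qed
    then have "T(-1 := Blank) = T" using Blank by auto
    then show ?thesis
      using ok less[of T] h * by (auto simp: clock_ok_def clock_upper_def clock_lower_def t)
  next
    case (Bit b)
    then have h: "0 \<le> h" "h < int n" using sym by auto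
    then obtain i where i: "h = int i" "i < n" by (metis nonneg_int_cases of_nat_less_iff)
    show ?thesis
    proof (cases m)
      case False
      then have *: "m' = False" "a = (Bit b, Left)" using a Bit by (auto simp: t)
      have "T(h := Bit b) = T" using Bit by auto
      then show ?thesis
        using ok less[of T] h False * by (auto simp: clock_ok_def clock_upper_def clock_lower_def t)
    next
      case m: True
      show ?thesis
      proof (cases b)
        case True
        then have *: "m' = True" "a = (Bit False, Right)" using a Bit m by (auto simp: t)
        have v: "clock_value n (T(h := Bit False)) + 2 ^ i = clock_value n T"
          using clock_value_upd[OF i(2), of T "Bit False"] Bit True i by auto
        have "nat (h + 1) = Suc i" using i by auto
        moreover have v2: "clock_value n (T(int i := Bit False)) + 2 * 2 ^ i = clock_value n T + 2 ^ i"
          using v i by simp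
        ultimately show ?thesis
          using ok m * h i Bit True by (auto simp: clock_ok_def clock_upper_def clock_lower_def t v2)
      next
        case False
        then have *: "m' = False" "a = (Bit True, Left)" using a Bit m by (auto simp: t)
        have v: "clock_value n (T(h := Bit True)) = clock_value n T + 2 ^ i"
          using clock_value_upd[OF i(2), of T "Bit True"] Bit False i by auto
        have "(2 ^ n - (clock_value n T + 2 ^ i)) * (2 * n + 4) =
            (2 ^ n - (clock_value n T + 2 ^ i + 1)) * (2 * n + 4) + (2 * n + 4)"
          using less[of "T(h := Bit True)"] v
          by (metis (no_types, lifting) Suc_diff_Suc Suc_eq_plus1 add.commute mult_Suc)
        then show ?thesis
          using ok m * h i Bit False v by (auto simp: clock_ok_def clock_upper_def clock_lower_def t)
      qed
    qed
  next
    case (Aux j)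
    then show ?thesis using a by (cases m; simp add: t)
  qed
  then show "clock_ok n m' (act a t)" "clock_upper n m' (act a t) < clock_upper n m t"
    "clock_lower n m t \<le> clock_lower n m' (act a t) + 1" by auto
qed

lemma clock_running:
  assumes ok: "clock_ok n m t" and "clock_lower n m t > 0"
  shows "\<exists>m' a. clock_action m (scan t) = Some (m', a)"
proof -
  obtain h T where t: "t = (h, T)" by (cases t)
  show ?thesis
  proof (cases "0 \<le> h \<and> h < int n")
    case True
    then obtain b where "T h = Bit b" using clock_ok_cell[of n m h T h] ok by (auto simp: t)
    then show ?thesis by (cases m; cases b) (auto simp: t)
  next
    case False
    then have "T h = Blank" using ok by (simp add: clock_ok_def t)
    moreover have "\<not> m" using False assms by (auto simp: clock_ok_def clock_lower_def t)
    ultimately show ?thesis by (auto simp: t)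
  qed
qed

lemma clock_value_zero: "clock_value n (word_at 0 (replicate n False)) = 0"
  by (auto simp: clock_value_def word_at_def)

lemma clock_initial:
  "clock_ok n True (0, word_at 0 (replicate n False))"
  "clock_lower n True (0, word_at 0 (replicate n False)) = 2 ^ n - 1"
  "clock_upper n True (0, word_at 0 (replicate n False)) = (2 ^ n - 1) * (2 * n + 4) + n"
  by (auto simp: clock_ok_def clock_lower_def clock_upper_def clock_value_zero)
     (auto simp: word_at_def)

section \<open>Guessing a short program\<close>

text \<open>
  On input w the machine guesses a program d shorter than w, runs U on d while the clock on the
  second tape is running, and compares the output with w. Program and clock are written from
  right to left while all heads return from the end of the input; a \<open>Skip\<close> at the
  last cell keeps the program shorter than the input.
\<close>

datatype guess_state = Seek | Skip | Guess | Run bool nat | Compare | Yes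

instance guess_state :: countable
  by countable_datatype

definition guess_delta :: "nat tm \<Rightarrow> guess_state trans" where
  "guess_delta U q us =
     (case us of
        a # b # ss \<Rightarrow>
          (case q of
             Seek \<Rightarrow> if a = Blank then {(Skip, all_move Left us)} else {(Seek, all_move Right us)}
           | Skip \<Rightarrow> if a = Blank then {(Run True (start U), all_move Right us)}
                    else (\<lambda>q'. (q', (a, Left) # (Bit False, Left) # all_move Left ss)) ` {Skip, Guess}
           | Guess \<Rightarrow> if a = Blank then {(Run True (start U), all_move Right us)}
                     else (\<lambda>x. (Guess, (a, Left) # (Bit False, Left) # (Bit x, Left) # all_move Left (tl ss)))
                            ` UNIV
           | Run m p \<Rightarrow> if delta U p ss = {} then {(Compare, all_move Stay us)}
                       else (case clock_action m b of
                               None \<Rightarrow> {}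
                             | Some (m', x) \<Rightarrow>
                                 (\<lambda>(p', acts). (Run m' p', (a, Stay) # x # acts)) ` delta U p ss)
           | Compare \<Rightarrow> if a \<noteq> last ss then {}
                       else if a = Blank then {(Yes, all_move Stay us)}
                       else {(Compare, all_move Right us)}
           | Yes \<Rightarrow> {})
      | _ \<Rightarrow> {})"

lemma transition_system_guess:
  assumes "well_formed U"
  shows "transition_system (tapes U + 2)
     ({Seek, Skip, Guess, Compare, Yes} \<union> (\<lambda>(m, p). Run m p) ` (UNIV \<times> states U))
     (symbols U) (guess_delta U) Seek"
  (is "transition_system _ ?Q _ _ _")
proof
  show "finite (guess_delta U q us)" for q us
    using finite_delta[OF assms]
    by (auto simp: guess_delta_def split: list.split guess_state.split option.split)
  fix q us q' acts
  assume q: "q \<in> ?Q" and us: "length us = tapes U + 2" "set us \<subseteq> symbols U"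
    and *: "(q', acts) \<in> guess_delta U q us"
  obtain a b ss where us_eq: "us = a # b # ss" "length ss = tapes U"
    using us(1) by (cases us; cases "tl us") auto
  have ss: "length (tl ss) = tapes U - 1" "tapes U > 0" "a \<in> symbols U" "b \<in> symbols U" "set ss \<subseteq> symbols U"
    "set (tl ss) \<subseteq> symbols U"
    using us us_eq assms by (auto simp: well_formed_def) (cases ss; auto)
  have clk: "s \<in> symbols U" if "clock_action m b = Some (m', s, d)" for m m' s d
    using that by (cases "(m, b)" rule: clock_action.cases) auto
  show "q' \<in> ?Q \<and> length acts = tapes U + 2 \<and> fst ` set acts \<subseteq> symbols U"
  proof (cases q)
    case (Run m p)
    then show ?thesis
      using * ss us_eq delta_closed[OF assms] clk
      by (auto simp: guess_delta_def split: if_splits option.splits dest: delta_symbols[OF assms])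
  qed (use * ss us_eq in \<open>auto simp: guess_delta_def split: if_splits\<close>)
qed (use assms in \<open>auto simp: finite_tm_states finite_tm_symbols well_formed_def\<close>)


lemma scan_heads_at_Cons: "map scan (heads_at i (T # Ts)) = T i # map scan (heads_at i Ts)"
  by (simp add: heads_at_def)

lemma dstep_iff_image:
  "dstep \<delta> (q, ts) c \<longleftrightarrow> c \<in> (\<lambda>(q', acts). (q', map2 act acts ts)) ` \<delta> q (map scan ts)"
  by (auto simp: dstep_def)

lemma accepting_from_branch:
  assumes "\<And>c'. dstep \<delta> c c' \<longleftrightarrow> c' \<in> D" "D \<noteq> {}"
  shows "accepting_from \<delta> F c \<longleftrightarrow> (\<exists>d \<in> D. accepting_from \<delta> F d)"
  by (subst accepting_from_unfold) (use assms in blast)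

lemma card_delta_le: "well_formed M \<Longrightarrow> deterministic M \<Longrightarrow> card (delta M q ss) \<le> 1"
  using finite_delta[of M q ss] by (auto simp: card_le_Suc0_iff_eq deterministic_def delta_def)

definition run_bound :: "nat \<Rightarrow> nat" where
  "run_bound n = (2 ^ n - 1) * (2 * n + 4) + 2 * n + 3"

context
  fixes U :: "nat tm" and w :: word and n :: nat
  assumes wf: "well_formed U" and det: "deterministic U" and n: "n = length w"
begin

private abbreviation "gd \<equiv> guess_delta U"

private abbreviation "acc \<equiv> accepting_from gd {Yes}"

lemma tree_bound_Yes: "tree_bound gd (Yes, ts) 1"
  by (rule tree_boundI[where s = 0]) (auto simp: dstep_def guess_delta_def split: list.splits)

lemma compare:
  assumes "ts \<noteq> []" "last ts = (h, T)" "i \<le> n"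
  shows "(acc (Compare, (int i, word_at 0 w) # t # ts) \<longleftrightarrow>
            (\<forall>j. i \<le> j \<and> j < n \<longrightarrow> T (h + int (j - i)) = Bit (w ! j)) \<and> T (h + int (n - i)) = Blank) \<and>
         tree_bound gd (Compare, (int i, word_at 0 w) # t # ts) (n - i + 2)"
  using assms
proof (induction "n - i" arbitrary: i h t ts)
  case 0
  then have [simp]: "i = n" by simp
  let ?c = "(Compare, (int i, word_at 0 w) # t # ts)"
  have b: "word_at 0 w (int n) = Blank" using n by simp
  have l: "last (map scan ts) = T h" using 0 by (simp add: last_map)
  let ?d = "(Yes, map (\<lambda>(h, T). (move Stay h, T)) ((int i, word_at 0 w) # t # ts))"
  have "gd Compare (map scan ((int i, word_at 0 w) # t # ts)) =
      (if T h = Blank then {(Yes, all_move Stay (map scan ((int i, word_at 0 w) # t # ts)))} else {})"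
    using b l by (auto simp: guess_delta_def simp del: word_at_eq_Blank_iff)
  then have *: "dstep gd ?c c \<longleftrightarrow> T h = Blank \<and> c = ?d" for c
    unfolding dstep_iff_image by (simp add: all_move_eq_map2 del: list.map)
  have Y: "acc ?d" by (subst accepting_from_unfold) (auto simp: dstep_def guess_delta_def)
  have "acc ?c \<longleftrightarrow> T h = Blank"
    by (subst accepting_from_unfold) (use * Y in auto)
  moreover have "tree_bound gd ?c (1 + 1 * 1)"
    by (rule tree_bound_step) (use * tree_bound_Yes b l in \<open>auto simp: guess_delta_def\<close>)
  ultimately show ?case by auto
next
  case (Suc k)
  let ?c = "(Compare, (int i, word_at 0 w) # t # ts)"
  have i: "i < n" using Suc.hyps(2) by simp
  then have b: "word_at 0 w (int i) = Bit (w ! i)" using n by (simp add: word_at_def)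
  have l: "last (map scan ts) = T h" using Suc by (simp add: last_map)
  let ?ts = "map (\<lambda>(h, T). (move Right h, T)) ts"
  obtain ht Tt where t: "t = (ht, Tt)" by (cases t)
  let ?d = "(Compare, (int (Suc i), word_at 0 w) # (ht + 1, Tt) # ?ts)"
  have "map2 act (all_move Right (map scan ((int i, word_at 0 w) # t # ts))) ((int i, word_at 0 w) # t # ts) =
     (int (Suc i), word_at 0 w) # (ht + 1, Tt) # ?ts"
    by (subst all_move_eq_map2) (simp add: t add.commute)
  then have *: "dstep gd ?c c \<longleftrightarrow> T h = Bit (w ! i) \<and> c = ?d" for c
    using b l by (auto simp: dstep_def guess_delta_def)
  have IH: "(acc ?d \<longleftrightarrow> (\<forall>j. Suc i \<le> j \<and> j < n \<longrightarrow> T (h + 1 + int (j - Suc i)) = Bit (w ! j)) \<and>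
      T (h + 1 + int (n - Suc i)) = Blank) \<and> tree_bound gd ?d (n - Suc i + 2)"
    using Suc.prems i Suc.hyps(2) by (intro Suc.hyps(1)) (auto simp: last_map)
  have "acc ?c \<longleftrightarrow> T h = Bit (w ! i) \<and> acc ?d"
    by (subst accepting_from_unfold) (use * in auto)
  moreover have "(\<forall>j. i \<le> j \<and> j < n \<longrightarrow> T (h + int (j - i)) = Bit (w ! j)) \<longleftrightarrow>
      T h = Bit (w ! i) \<and> (\<forall>j. Suc i \<le> j \<and> j < n \<longrightarrow> T (h + 1 + int (j - Suc i)) = Bit (w ! j))"
    (is "?L \<longleftrightarrow> ?R")
  proof -
    have "h + int (j - i) = h + 1 + int (j - Suc i)" if "Suc i \<le> j" for j using that by auto
    then show ?thesis using i
      by (metis Suc_leI diff_self_eq_0 le_neq_implies_less le_refl of_nat_0 add.right_neutral Suc_leD)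
  qed
  moreover have "h + int (n - i) = h + 1 + int (n - Suc i)" using i by auto
  moreover have "tree_bound gd ?c (1 + 1 * (n - Suc i + 2))"
    by (rule tree_bound_step) (use * IH in \<open>auto simp: guess_delta_def\<close>)
  ultimately show ?case
    using IH Suc.hyps(2) by (simp add: Suc_diff_Suc i)
qed

lemma compare_output:
  assumes "length ts = tapes U"
  shows "acc (Compare, (0, word_at 0 w) # t # ts) \<longleftrightarrow> has_output (q, ts) w"
    and "tree_bound gd (Compare, (0, word_at 0 w) # t # ts) (n + 2)"
proof -
  have "ts \<noteq> []" using assms wf by (auto simp: well_formed_def)
  moreover obtain h T where "last ts = (h, T)" by (cases "last ts")
  ultimately show "acc (Compare, (0, word_at 0 w) # t # ts) \<longleftrightarrow> has_output (q, ts) w"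
    "tree_bound gd (Compare, (0, word_at 0 w) # t # ts) (n + 2)"
    using compare[of ts h T 0 t] n by (auto simp: has_output_def)
qed

lemma run_halted:
  assumes "length ts = tapes U" "halted U (q, ts)"
  shows "acc (Run m q, (0, word_at 0 w) # t # ts) \<longleftrightarrow> has_output (q, ts) w"
    and "tree_bound gd (Run m q, (0, word_at 0 w) # t # ts) (n + 3)"
proof -
  let ?c = "(Run m q, (0, word_at 0 w) # t # ts)" and ?d = "(Compare, (0, word_at 0 w) # t # ts)"
  have emp: "delta U q (map scan ts) = {}"
    using assms(2) by (auto simp: halted_def step_eq_dstep dstep_def)
  have stay: "map (\<lambda>(h, T). (move Stay h, T)) ts' = ts'" for ts' by (induction ts') auto
  have "gd (Run m q) (map scan ((0, word_at 0 w) # t # ts)) =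
      {(Compare, all_move Stay (map scan ((0, word_at 0 w) # t # ts)))}"
    using emp by (simp add: guess_delta_def)
  then have *: "dstep gd ?c c \<longleftrightarrow> c = ?d" for c
    unfolding dstep_iff_image by (simp only: image_insert image_empty case_prod_conv all_move_eq_map2 stay singleton_iff)
  show "acc ?c \<longleftrightarrow> has_output (q, ts) w"
    unfolding accepting_from_step[of gd ?c ?d, OF *] using compare_output(1)[OF assms(1)] .
  have "tree_bound gd ?c (1 + 1 * (n + 2))"
    by (rule tree_bound_step) (use * compare_output(2)[OF assms(1)] emp in \<open>auto simp: guess_delta_def\<close>)
  then show "tree_bound gd ?c (n + 3)" by (rule tree_bound_mono) simp
qed

lemma run_step:
  assumes "\<not> halted U (q, ts)" "clock_action m (scan t) = Some (m', a)"
  shows "dstep gd (Run m q, (0, word_at 0 w) # t # ts) c \<longleftrightarrow>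
     (\<exists>q' ts'. step U (q, ts) (q', ts') \<and> c = (Run m' q', (0, word_at 0 w) # act a t # ts'))"
proof -
  have "delta U q (map scan ts) \<noteq> {}"
    using assms(1) by (auto simp: halted_def step_eq_dstep dstep_def)
  moreover have "(word_at 0 w)(0 := word_at 0 w 0) = word_at 0 w" by auto
  ultimately show ?thesis
    using assms(2) unfolding step_eq_dstep dstep_iff_image
    by (cases a; cases t) (auto simp: guess_delta_def image_image case_prod_beta image_iff Bex_def)
qed

lemma step_length:
  assumes "step U (q, ts) (q', ts')" "length ts = tapes U"
  shows "length ts' = tapes U"
  using assms delta_closed[OF wf] by (auto simp: step_eq_dstep dstep_def)

lemma run_sound:
  assumes "clock_ok n m t" "length ts = tapes U"
  shows "tree_bound gd (Run m q, (0, word_at 0 w) # t # ts) (clock_upper n m t + n + 3) \<and>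
     (acc (Run m q, (0, word_at 0 w) # t # ts) \<longrightarrow>
        (\<exists>k c. (step U ^^ k) (q, ts) c \<and> halted U c \<and> has_output c w))"
  using assms
proof (induction "clock_upper n m t" arbitrary: m q t ts rule: less_induct)
  case less
  let ?c = "(Run m q, (0, word_at 0 w) # t # ts)"
  show ?case
  proof (cases "halted U (q, ts)")
    case True
    have "(step U ^^ 0) (q, ts) (q, ts)" by simp
    then show ?thesis
      using run_halted[OF less.prems(2) True] True by (blast intro: tree_bound_mono le_add2 add_le_mono)
  next
    case False
    show ?thesis
    proof (cases "clock_action m (scan t)")
      case None
      then have no: "gd (fst ?c) (map scan (snd ?c)) = {}"
        using False by (auto simp: guess_delta_def halted_def step_eq_dstep dstep_def)
      then have "\<not> dstep gd ?c c" for c by (simp add: dstep_def)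
      then show ?thesis
        using no by (subst accepting_from_unfold) (auto intro: tree_boundI[where s = 0])
    next
      case (Some ma)
      obtain m' a where ma: "clock_action m (scan t) = Some (m', a)" using Some by (cases ma) auto
      note * = run_step[OF False ma] and clk = clock_step[OF less.prems(1) ma]
      have IH: "tree_bound gd (Run m' q', (0, word_at 0 w) # act a t # ts') (clock_upper n m' (act a t) + n + 3) \<and>
         (acc (Run m' q', (0, word_at 0 w) # act a t # ts') \<longrightarrow>
            (\<exists>k c. (step U ^^ k) (q', ts') c \<and> halted U c \<and> has_output c w))"
        if "step U (q, ts) (q', ts')" for q' ts'
        using less.hyps[OF clk(2,1)] step_length[OF that less.prems(2)] .
      have "card (gd (fst ?c) (map scan (snd ?c))) \<le> 1"
        using ma order_trans[OF card_image_le[OF finite_delta[OF wf]] card_delta_le[OF wf det]]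
        by (auto simp: guess_delta_def)
      moreover have "tree_bound gd c (clock_upper n m' (act a t) + n + 3)" if "dstep gd ?c c" for c
        using that IH unfolding * by auto
      ultimately have "tree_bound gd ?c (1 + 1 * (clock_upper n m' (act a t) + n + 3))"
        by (rule tree_bound_step[rotated])
      then have "tree_bound gd ?c (clock_upper n m t + n + 3)"
        by (rule tree_bound_mono) (use clk(2) in simp)
      moreover have "\<exists>k c. (step U ^^ k) (q, ts) c \<and> halted U c \<and> has_output c w" if accc: "acc ?c"
      proof -
        obtain q' ts' where "step U (q, ts) (q', ts')" "acc (Run m' q', (0, word_at 0 w) # act a t # ts')"
          using accc unfolding accepting_from_unfold[of _ _ ?c] unfolding * by auto
        then show ?thesis using IH relpowp_Suc_I2[of "step U"] by meson
      qed
      ultimately show ?thesis by blast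
    qed
  qed
qed

lemma run_complete:
  assumes "clock_ok n m t" "length ts = tapes U" "(step U ^^ k) (q, ts) c" "halted U c" "has_output c w"
    "k \<le> clock_lower n m t"
  shows "acc (Run m q, (0, word_at 0 w) # t # ts)"
  using assms
proof (induction k arbitrary: m q t ts)
  case 0
  then show ?case using run_halted(1)[of ts q m t] by simp
next
  case (Suc k)
  obtain q' ts' where s: "step U (q, ts) (q', ts')" "(step U ^^ k) (q', ts') c"
    using relpowp_Suc_D2[OF Suc.prems(3)] by (metis prod.collapse)
  then have nh: "\<not> halted U (q, ts)" by (auto simp: halted_def)
  obtain m' a where ma: "clock_action m (scan t) = Some (m', a)"
    using clock_running[OF Suc.prems(1)] Suc.prems(6) by fastforce
  note clk = clock_step[OF Suc.prems(1) ma]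
  have "acc (Run m' q', (0, word_at 0 w) # act a t # ts')"
    using Suc.prems clk s by (intro Suc.IH) (auto intro: step_length)
  moreover have "dstep gd (Run m q, (0, word_at 0 w) # t # ts) (Run m' q', (0, word_at 0 w) # act a t # ts')"
    using run_step[OF nh ma] s by blast
  ultimately show ?case by (subst accepting_from_unfold) blast
qed

definition phase :: "guess_state \<Rightarrow> nat \<Rightarrow> word \<Rightarrow> guess_state config" where
  "phase q r d = (q, heads_at (int r - 1) (word_at 0 w # word_at (int r) (replicate (n - r) False) #
      word_at (int r) d # replicate (tapes U - 1) (\<lambda>_. Blank)))"

definition run_config :: "word \<Rightarrow> guess_state config" where
  "run_config d = (Run True (start U), heads_at 0 (word_at 0 w # word_at 0 (replicate n False) #
      word_at 0 d # replicate (tapes U - 1) (\<lambda>_. Blank)))"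

lemma phase_0: "q \<in> {Skip, Guess} \<Longrightarrow> dstep gd (phase q 0 d) c \<longleftrightarrow> c = run_config d"
  unfolding phase_def run_config_def
  by (subst dstep_move_iff[where d = Right and q' = "Run True (start U)"])
     (auto simp: guess_delta_def scan_heads_at_Cons)

lemma write_step:
  assumes "r < n"
  shows "map2 act ((word_at 0 w (int r), Left) # (Bit False, Left) # (Bit x, Left) #
             all_move Left (map scan (heads_at (int r) (replicate k (\<lambda>_. Blank)))))
           (heads_at (int r) (word_at 0 w # word_at (int r + 1) (replicate (n - Suc r) False) #
             word_at (int r + 1) d # replicate k (\<lambda>_. Blank))) =
         heads_at (int r - 1) (word_at 0 w # word_at (int r) (replicate (n - r) False) #
             word_at (int r) (x # d) # replicate k (\<lambda>_. Blank))"
proof -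
  have "n - r = Suc (n - Suc r)" using assms by simp
  then show ?thesis
    using all_move_heads_at[of Left "int r" "replicate k (\<lambda>_. Blank)"]
    by (simp add: heads_at_def word_at_Cons fun_upd_idem)
qed

lemma phase_Guess:
  assumes "r < n"
  shows "dstep gd (phase Guess (Suc r) d) c \<longleftrightarrow> (\<exists>x. c = phase Guess r (x # d))"
proof -
  have "word_at 0 w (int r) \<noteq> Blank" using assms n by simp
  then show ?thesis
    using write_step[OF assms, of _ "tapes U - 1" d] unfolding phase_def dstep_iff_image
    by (auto simp: guess_delta_def scan_heads_at_Cons add.commute image_image)
qed

lemma phase_Skip:
  assumes "r < n"
  shows "dstep gd (phase Skip (Suc r) []) c \<longleftrightarrow> (\<exists>q \<in> {Skip, Guess}. c = phase q r [])"
proof -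
  have b: "word_at 0 w (int r) \<noteq> Blank" using assms n by simp
  have "n - r = Suc (n - Suc r)" using assms by simp
  then have "map2 act ((word_at 0 w (int r), Left) # (Bit False, Left) # all_move Left (map scan (heads_at (int r) Ts)))
           (heads_at (int r) (word_at 0 w # word_at (int r + 1) (replicate (n - Suc r) False) # Ts)) =
         heads_at (int r - 1) (word_at 0 w # word_at (int r) (replicate (n - r) False) # Ts)" for Ts
    using all_move_heads_at[of Left "int r" Ts]
    by (simp add: heads_at_def word_at_Cons fun_upd_idem)
  from this[of "(\<lambda>_. Blank) # replicate (tapes U - 1) (\<lambda>_. Blank)"] show ?thesis
    using b by (auto simp: phase_def dstep_def guess_delta_def scan_heads_at_Cons add.commute)
qed

lemma run_config_eq:
  "run_config d = (Run True (start U), (0, word_at 0 w) # (0, word_at 0 (replicate n False)) # snd (init U d))"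
  by (simp add: run_config_def init_eq heads_at_def)

lemma length_init: "length (snd (init U d)) = tapes U"
  using wf by (simp add: init_def well_formed_def)

lemma tree_bound_run_config: "tree_bound gd (run_config d) (run_bound n)"
proof -
  have "tree_bound gd (run_config d) ((2 ^ n - 1) * (2 * n + 4) + n + n + 3)"
    using run_sound[OF clock_initial(1) length_init, THEN conjunct1, of "start U" d]
    unfolding clock_initial(3) run_config_eq .
  then show ?thesis by (rule tree_bound_mono) (simp add: run_bound_def)
qed

lemma acc_run_config_sound:
  assumes "acc (run_config d)"
  shows "\<exists>t. prints_within U d t w"
  using run_sound[OF clock_initial(1) length_init, THEN conjunct2, of "start U" d] assms
  unfolding run_config_eq prints_within_def init_eq by auto

lemma acc_run_config_complete:
  assumes "prints_within U d t w" "t < 2 ^ n"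
  shows "acc (run_config d)"
proof -
  obtain k c where "k \<le> t" "(step U ^^ k) (start U, snd (init U d)) c" "halted U c" "has_output c w"
    using assms(1) by (auto simp: prints_within_def init_eq)
  then show ?thesis
    unfolding run_config_eq using assms(2)
    by (intro run_complete[OF clock_initial(1) length_init]) (auto simp: clock_initial(2))
qed

lemma guess_phase:
  "r \<le> n \<Longrightarrow> (acc (phase Guess r d) \<longleftrightarrow> (\<exists>e. length e = r \<and> acc (run_config (e @ d)))) \<and>
     tree_bound gd (phase Guess r d) (3 ^ r * (run_bound n + 1))"
proof (induction r arbitrary: d)
  case 0
  have "tree_bound gd (phase Guess 0 d) (1 + 1 * run_bound n)"
  proof (rule tree_bound_step)
    show "tree_bound gd c' (run_bound n)" if "dstep gd (phase Guess 0 d) c'" for c'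
      using that phase_0 tree_bound_run_config by auto
  qed (auto simp: phase_def guess_delta_def scan_heads_at_Cons)
  then show ?case using accepting_from_step[of gd "phase Guess 0 d", OF phase_0] by simp
next
  case (Suc r)
  have r: "r < n" using Suc.prems by simp
  have "tree_bound gd (phase Guess (Suc r) d) (1 + 2 * (3 ^ r * (run_bound n + 1)))"
  proof (rule tree_bound_step)
    show "tree_bound gd c' (3 ^ r * (run_bound n + 1))" if "dstep gd (phase Guess (Suc r) d) c'" for c'
      using that Suc phase_Guess[OF r] by auto
    show "card (gd (fst (phase Guess (Suc r) d)) (map scan (snd (phase Guess (Suc r) d)))) \<le> 2"
      using card_image_le[of "UNIV :: bool set"]
      by (auto simp: phase_def guess_delta_def scan_heads_at_Cons)
  qed
  then have "tree_bound gd (phase Guess (Suc r) d) (3 ^ Suc r * (run_bound n + 1))"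
    by (rule tree_bound_mono) (simp add: Suc_le_eq)
  moreover have "acc (phase Guess (Suc r) d) \<longleftrightarrow> (\<exists>x. acc (phase Guess r (x # d)))"
    using accepting_from_branch[of gd "phase Guess (Suc r) d" "range (\<lambda>x. phase Guess r (x # d))"]
      phase_Guess[OF r, of d] by auto
  moreover have "\<dots> \<longleftrightarrow> (\<exists>x e. length e = r \<and> acc (run_config (e @ x # d)))"
    using Suc r by auto
  moreover have "(\<exists>x e. length e = r \<and> acc (run_config (e @ x # d))) \<longleftrightarrow>
      (\<exists>e. length e = Suc r \<and> acc (run_config (e @ d)))"
    (is "?L \<longleftrightarrow> ?R")
  proof
    assume ?L
    then obtain x e where "length e = r" "acc (run_config (e @ x # d))" by blast
    then show ?R by (intro exI[of _ "e @ [x]"]) simp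
  next
    assume ?R
    then obtain x e where "length e = r" "acc (run_config (e @ [x] @ d))"
      by (auto simp: length_Suc_conv_rev)
    then show ?L by auto
  qed
  ultimately show ?case by blast
qed

lemma skip_phase:
  "r \<le> n \<Longrightarrow> (acc (phase Skip r []) \<longleftrightarrow> (\<exists>d. length d \<le> r - 1 \<and> acc (run_config d))) \<and>
     tree_bound gd (phase Skip r []) (3 ^ r * (run_bound n + 1))"
proof (induction r)
  case 0
  have "tree_bound gd (phase Skip 0 []) (1 + 1 * run_bound n)"
  proof (rule tree_bound_step)
    show "tree_bound gd c' (run_bound n)" if "dstep gd (phase Skip 0 []) c'" for c'
      using that phase_0 tree_bound_run_config by auto
  qed (auto simp: phase_def guess_delta_def scan_heads_at_Cons)
  then show ?case using accepting_from_step[of gd "phase Skip 0 []", OF phase_0] by simp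
next
  case (Suc r)
  have r: "r < n" using Suc.prems by simp
  have "tree_bound gd (phase Skip (Suc r) []) (1 + 2 * (3 ^ r * (run_bound n + 1)))"
  proof (rule tree_bound_step)
    show "tree_bound gd c' (3 ^ r * (run_bound n + 1))" if "dstep gd (phase Skip (Suc r) []) c'" for c'
      using that Suc phase_Skip[OF r] guess_phase[of r "[]"] by auto
    show "card (gd (fst (phase Skip (Suc r) [])) (map scan (snd (phase Skip (Suc r) [])))) \<le> 2"
      by (auto simp: phase_def guess_delta_def scan_heads_at_Cons card_insert_if)
  qed
  then have "tree_bound gd (phase Skip (Suc r) []) (3 ^ Suc r * (run_bound n + 1))"
    by (rule tree_bound_mono) (simp add: Suc_le_eq)
  moreover have "acc (phase Skip (Suc r) []) \<longleftrightarrow> acc (phase Skip r []) \<or> acc (phase Guess r [])"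
    using accepting_from_branch[of gd "phase Skip (Suc r) []" "{phase Skip r [], phase Guess r []}"]
      phase_Skip[OF r] by auto
  moreover have "\<dots> \<longleftrightarrow> (\<exists>d. length d \<le> r - 1 \<and> acc (run_config d)) \<or> (\<exists>d. length d = r \<and> acc (run_config d))"
    using Suc r guess_phase[of r "[]"] by auto
  moreover have "\<dots> \<longleftrightarrow> (\<exists>d. length d \<le> r \<and> acc (run_config d))"
  proof -
    have "l \<le> r \<longleftrightarrow> l \<le> r - 1 \<or> l = r" for l by auto
    then show ?thesis by blast
  qed
  ultimately show ?case by simp
qed

lemma seek_phase:
  assumes "i \<le> n"
  defines "Ts \<equiv> word_at 0 w # replicate (Suc (tapes U)) (\<lambda>_. Blank)"
  shows "(acc (Seek, heads_at (int i) Ts) \<longleftrightarrow> (\<exists>d. length d \<le> n - 1 \<and> acc (run_config d))) \<and>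
     tree_bound gd (Seek, heads_at (int i) Ts) (n - i + 1 + 3 ^ n * (run_bound n + 1))"
  using assms(1)
proof (induction "n - i" arbitrary: i)
  case 0
  then have [simp]: "i = n" by simp
  obtain k where "tapes U = Suc k" using wf by (cases "tapes U") (auto simp: well_formed_def)
  then have ph: "phase Skip n [] = (Skip, heads_at (move Left (int n)) Ts)"
    by (simp add: phase_def Ts_def)
  have *: "dstep gd (Seek, heads_at (int n) Ts) c \<longleftrightarrow> c = phase Skip n []" for c
    unfolding ph by (rule dstep_move_iff) (simp add: guess_delta_def Ts_def scan_heads_at_Cons n)
  have "tree_bound gd (Seek, heads_at (int n) Ts) (1 + 1 * (3 ^ n * (run_bound n + 1)))"
    by (rule tree_bound_step)
       (use * skip_phase[of n] in \<open>auto simp: guess_delta_def Ts_def scan_heads_at_Cons\<close>)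
  then show ?case
    using accepting_from_step[of gd "(Seek, heads_at (int n) Ts)", OF *] skip_phase[of n] by simp
next
  case (Suc k)
  then have i: "i < n" by simp
  have mv: "move Right (int i) = int (Suc i)" by simp
  have *: "dstep gd (Seek, heads_at (int i) Ts) c \<longleftrightarrow> c = (Seek, heads_at (int (Suc i)) Ts)" for c
    unfolding mv[symmetric]
    by (rule dstep_move_iff) (use i n in \<open>simp add: guess_delta_def Ts_def scan_heads_at_Cons\<close>)
  have IH: "(acc (Seek, heads_at (int (Suc i)) Ts) \<longleftrightarrow> (\<exists>d. length d \<le> n - 1 \<and> acc (run_config d))) \<and>
     tree_bound gd (Seek, heads_at (int (Suc i)) Ts) (n - Suc i + 1 + 3 ^ n * (run_bound n + 1))"
    using Suc.hyps(2) i by (intro Suc.hyps(1)) auto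
  have "tree_bound gd (Seek, heads_at (int i) Ts) (1 + 1 * (n - Suc i + 1 + 3 ^ n * (run_bound n + 1)))"
    by (rule tree_bound_step) (use * IH in \<open>auto simp: guess_delta_def Ts_def scan_heads_at_Cons\<close>)
  moreover have "1 + 1 * (n - Suc i + 1 + 3 ^ n * (run_bound n + 1)) = n - i + 1 + 3 ^ n * (run_bound n + 1)"
    using i by simp
  ultimately show ?case
    using accepting_from_step[of gd "(Seek, heads_at (int i) Ts)", OF *] IH by metis
qed

end

lemma complement_DTIME:
  assumes "A \<in> DTIME T"
  shows "- A \<in> DTIME T"
proof -
  obtain M :: "nat tm" and f where M: "well_formed M" "deterministic M" "decides_in_time M A f"
    and f: "(\<lambda>n. real (f n)) \<in> O(\<lambda>n. real (T n))"
    using assms by (auto simp: DTIME_def)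
  define M' where "M' = M\<lparr>accepting := - accepting M\<rparr>"
  have [simp]: "delta M' = delta M" "init M' x = init M x" "accepting M' = - accepting M" for x
    by (auto simp: M'_def delta_def init_def fun_eq_iff)
  have wf: "well_formed M'" "deterministic M'"
    using M by (auto simp: well_formed_def deterministic_def M'_def)
  have "accepts M' x \<longleftrightarrow> \<not> accepts M x" for x
  proof -
    have b: "bounded_from (delta M) (init M x) (f (length x))"
      using M(3) by (simp add: decides_in_time_def halts_within_iff)
    define N where "N = (GREATEST n. \<exists>c. (dstep (delta M) ^^ n) (init M x) c)"
    have "\<exists>c. (dstep (delta M) ^^ N) (init M x) c" unfolding N_def
      by (rule GreatestI_nat[of _ 0 "f (length x)"]) (use b in \<open>auto simp: bounded_from_def\<close>)
    then obtain c where c: "(dstep (delta M) ^^ N) (init M x) c" by blast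
    have halt: "\<nexists>d. dstep (delta M) c d"
    proof
      assume "\<exists>d. dstep (delta M) c d"
      then have "\<exists>d. (dstep (delta M) ^^ Suc N) (init M x) d" using c relpowp_Suc_I by metis
      then have "Suc N \<le> N" unfolding N_def
        by (rule Greatest_le_nat[of _ _ "f (length x)"]) (use b in \<open>auto simp: bounded_from_def\<close>)
      then show False by simp
    qed
    have "accepting_from (delta M) F (init M x) \<longleftrightarrow> fst c \<in> F" for F
      using bounded_from_halting_run[OF c halt card_delta_le[OF M(1,2)] finite_delta[OF M(1)]] by blast
    then show ?thesis by (simp add: accepts_iff)
  qed
  then have "decides_in_time M' (- A) f"
    using M(3) by (auto simp: decides_in_time_def halts_within_iff)
  then show ?thesis using wf f unfolding DTIME_def by blast
qed

lemma short_program_bound_bigo: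
  "(\<lambda>n. real (K * (n + 1 + 3 ^ n * ((2 ^ n - 1) * (2 * n + 4) + 2 * n + 3 + 1)))) \<in>
     O(\<lambda>n. real (2 ^ (n ^ 2)))"
proof -
  have "(\<lambda>n. real (f n)) \<in> O(\<lambda>n. real (n ^ 1))" if "f = (\<lambda>n. n)" for f :: "nat \<Rightarrow> nat"
    using that by simp
  from exp_poly_bigo[OF this[OF refl], of "13 * K" 12]
  have "(\<lambda>n. real (13 * K * 12 ^ n)) \<in> O(\<lambda>n. real (2 ^ (n ^ 2)))" by (simp add: power2_eq_square)
  moreover have "(\<lambda>n. real (K * (n + 1 + 3 ^ n * ((2 ^ n - 1) * (2 * n + 4) + 2 * n + 3 + 1)))) \<in>
     O(\<lambda>n. real (13 * K * 12 ^ n))"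
  proof (rule bigoI[of _ 1], rule always_eventually, rule allI)
    fix n :: nat
    have n: "n < 2 ^ n" by simp
    have "(2 ^ n - 1) * (2 * n + 4) + 2 * n + 3 + 1 \<le> 2 ^ n * (2 * n + 4) + (2 * n + 4)"
      by (simp add: mult_right_mono)
    also have "\<dots> \<le> 2 ^ n * (2 * 2 ^ n + 4) + (2 * 2 ^ n + 4)"
      using n by (intro add_mono mult_left_mono) auto
    also have "\<dots> \<le> 12 * 4 ^ n"
    proof -
      have "(4 :: nat) ^ n = 2 ^ n * 2 ^ n" by (simp flip: power_mult_distrib)
      moreover have "2 * (a * a) + 4 * a + (2 * a + 4) \<le> 12 * (a * a)" if "a \<ge> 1" for a :: nat
        using that mult_le_mono[of 1 a 1 a] mult_le_mono[of 1 a a a] by linarith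
      from this[of "2 ^ n"] have "2 * (2 ^ n * 2 ^ n) + 4 * 2 ^ n + (2 * 2 ^ n + 4) \<le> 12 * (2 ^ n * 2 ^ n :: nat)"
        by simp
      ultimately show ?thesis by (simp add: algebra_simps)
    qed
    finally have "3 ^ n * ((2 ^ n - 1) * (2 * n + 4) + 2 * n + 3 + 1) \<le> 3 ^ n * (12 * 4 ^ n)"
      by (rule mult_le_mono2)
    also have "\<dots> = 12 * (12::nat) ^ n" by (simp flip: power_mult_distrib)
    finally have "n + 1 + 3 ^ n * ((2 ^ n - 1) * (2 * n + 4) + 2 * n + 3 + 1) \<le> 13 * 12 ^ n"
      using n power_mono[of 2 "12::nat" n] by linarith
    then have "K * (n + 1 + 3 ^ n * ((2 ^ n - 1) * (2 * n + 4) + 2 * n + 3 + 1)) \<le> 13 * K * 12 ^ n"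
      using mult_le_mono2[of _ "13 * 12 ^ n" K] by (simp only: mult.assoc mult.left_commute[of 13])
    then show "norm (real (K * (n + 1 + 3 ^ n * ((2 ^ n - 1) * (2 * n + 4) + 2 * n + 3 + 1)))) \<le>
        1 * norm (real (13 * K * 12 ^ n))"
      by (simp only: norm_of_nat mult_1 of_nat_le_iff)
  qed
  ultimately show ?thesis by (rule landau_o.big_trans[rotated])
qed

section \<open>An infinite set of Kt-hard words in EXP\<close>

lemma easy_words_EXP:
  fixes U :: "nat tm"
  assumes wf: "well_formed U" and det: "deterministic U"
  obtains L where "L \<in> DTIME (\<lambda>n. 2 ^ (n ^ 2))"
    "\<And>w d t. prints_within U d t w \<Longrightarrow> length d < length w \<Longrightarrow> t < 2 ^ length w \<Longrightarrow> w \<in> L"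
    "\<And>w. w \<in> L \<Longrightarrow> w \<noteq> [] \<Longrightarrow> \<exists>d t. length d < length w \<and> prints_within U d t w"
proof -
  interpret S: transition_system "tapes U + 2"
    "{Seek, Skip, Guess, Compare, Yes} \<union> (\<lambda>(m, p). Run m p) ` (UNIV \<times> states U)"
    "symbols U" "guess_delta U" Seek "{Yes}"
    by (rule transition_system_guess[OF wf])
  define L where "L = {w. accepts S.machine w}"
  have ini: "S.initial w = (Seek, heads_at 0 (word_at 0 w # replicate (Suc (tapes U)) (\<lambda>_. Blank)))" for w
    unfolding S.initial_def by simp
  note seek = seek_phase[OF wf det refl, of 0, unfolded of_nat_0, folded ini]
  have L: "w \<in> L \<longleftrightarrow> (\<exists>d. length d \<le> length w - 1 \<and>
      accepting_from (guess_delta U) {Yes} (run_config U w (length w) d))" for w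
    unfolding L_def mem_Collect_eq S.accepts_machine by (rule seek[THEN conjunct1]) simp
  have tb: "tree_bound (delta S.machine) (init S.machine w)
      (length w + 1 + 3 ^ length w * (run_bound (length w) + 1))" for w
    unfolding S.init_machine using seek[of w] by (intro S.tree_bound_machine S.valid_initial) simp
  obtain M' :: "nat tm" and K where M': "well_formed M'" "deterministic M'"
    "\<And>x s. tree_bound (delta S.machine) (init S.machine x) s \<Longrightarrow>
       halts_within M' x (K * s) \<and> (accepts M' x \<longleftrightarrow> accepts S.machine x)"
    by (rule search_machine[OF S.well_formed_machine]) blast
  have "decides_in_time M' L
      (\<lambda>n. K * (n + 1 + 3 ^ n * ((2 ^ n - 1) * (2 * n + 4) + 2 * n + 3 + 1)))"
    using M'(3)[OF tb] unfolding decides_in_time_def L_def run_bound_def mem_Collect_eq by blast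
  then have "L \<in> DTIME (\<lambda>n. 2 ^ (n ^ 2))"
    using M'(1,2) short_program_bound_bigo[of K] unfolding DTIME_def by blast
  moreover have "w \<in> L" if "prints_within U d t w" "length d < length w" "t < 2 ^ length w" for w d t
    using acc_run_config_complete[OF wf det refl that(1,3)] that(2) unfolding L by force
  moreover have "\<exists>d t. length d < length w \<and> prints_within U d t w" if wL: "w \<in> L" "w \<noteq> []" for w
  proof -
    obtain d where d: "length d \<le> length w - 1"
      "accepting_from (guess_delta U) {Yes} (run_config U w (length w) d)"
      using wL(1) unfolding L by blast
    moreover have "length d < length w" using d wL(2) by (cases w) auto
    ultimately show ?thesis using acc_run_config_sound[OF wf det refl, of w d] by blast
  qed
  ultimately show thesis by (rule that)
qed

lemma prints_within_unique:
  assumes wf: "well_formed U" and det: "deterministic U"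
    and "prints_within U d t w" "prints_within U d t' w'"
  shows "w = w'"
proof -
  obtain n c where c: "(dstep (delta U) ^^ n) (init U d) c" "\<nexists>e. dstep (delta U) c e" "has_output c w"
    using assms(3) by (auto simp: prints_within_def halted_def step_eq_dstep)
  obtain n' c' where c': "(dstep (delta U) ^^ n') (init U d) c'" "\<nexists>e. dstep (delta U) c' e" "has_output c' w'"
    using assms(4) by (auto simp: prints_within_def halted_def step_eq_dstep)
  have "c = c'"
    using halting_config_unique[OF card_delta_le[OF wf det] finite_delta[OF wf] c(1,2) c'(1,2)] .
  obtain h T where hT: "last (snd c) = (h, T)" by (cases "last (snd c)")
  have *: "\<forall>i < length w. T (h + int i) = Bit (w ! i)" "T (h + int (length w)) = Blank"
    "\<forall>i < length w'. T (h + int i) = Bit (w' ! i)" "T (h + int (length w')) = Blank"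
    using c(3) c'(3) by (auto simp: has_output_def hT \<open>c = c'\<close>[symmetric])
  then have "length w = length w'"
    by (metis linorder_neqE_nat symbol.distinct(1))
  then show ?thesis using * by (intro nth_equalityI) (metis symbol.inject(1))+
qed

lemma exists_unprintable_word:
  assumes wf: "well_formed U" and det: "deterministic U"
  shows "\<exists>w. length w = n \<and> \<not> (\<exists>d t. length d < n \<and> prints_within U d t w)"
proof (rule ccontr)
  assume "\<not> ?thesis"
  then have all: "\<exists>d. length d < n \<and> (\<exists>t. prints_within U d t w)" if "length w = n" for w
    using that by blast
  define W :: "word set" where "W = {w. length w = n}"
  define p where "p w = (SOME d. length d < n \<and> (\<exists>t. prints_within U d t w))" for w
  have p: "length (p w) < n \<and> (\<exists>t. prints_within U (p w) t w)" if "w \<in> W" for w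
    using someI_ex[OF all[of w]] that unfolding p_def W_def by blast
  then have "inj_on p W"
    by (intro inj_onI) (metis prints_within_unique[OF wf det])
  moreover have "p ` W \<subseteq> (\<Union>i<n. {d. set d \<subseteq> UNIV \<and> length d = i})" using p by auto
  moreover have fin: "finite {d :: word. set d \<subseteq> UNIV \<and> length d = i}" for i
    by (rule finite_lists_length_eq) simp
  ultimately have "card W \<le> card (\<Union>i<n. {d :: word. set d \<subseteq> UNIV \<and> length d = i})"
    by (intro card_inj_on_le) auto
  also have "\<dots> \<le> (\<Sum>i<n. card {d :: word. set d \<subseteq> UNIV \<and> length d = i})"
    by (rule card_UN_le) simp
  also have "\<dots> = (\<Sum>i<n. 2 ^ i)" by (subst card_lists_length_eq) auto
  also have "\<dots> < 2 ^ n" by (induction n) auto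
  finally show False
    using card_lists_length_eq[of "UNIV :: bool set" n] by (simp add: W_def)
qed

lemma Kt_less_iff:
  "Kt U w < ereal (real n) \<longleftrightarrow>
     (\<exists>d t. t \<ge> 1 \<and> prints_within U d t w \<and> real (length d) + log 2 (real t) < real n)"
  unfolding Kt_def Inf_less_iff by (simp flip: less_ereal.simps(1)) blast

lemma Kt_less_imp:
  assumes "Kt U w < ereal (real n)"
  shows "\<exists>d t. prints_within U d t w \<and> length d < n \<and> t < 2 ^ n"
proof -
  obtain d t where dt: "t \<ge> 1" "prints_within U d t w" "real (length d) + log 2 (real t) < real n"
    using assms Kt_less_iff by blast
  have "log 2 (real t) \<ge> 0" using dt(1) by simp
  then have "length d < n" using dt(3) by linarith
  have "log 2 (real t) < real n" using dt(3) by linarith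
  then have "real t < 2 powr real n" using dt(1) by (simp add: log_less_iff)
  then have "real t < real (2 ^ n)" by (simp add: powr_realpow)
  then have "t < 2 ^ n" by (simp only: of_nat_less_iff)
  with dt \<open>length d < n\<close> show ?thesis by blast
qed

lemma infinite_hard_EXP_set:
  assumes wf: "well_formed U" and det: "deterministic U"
  obtains B where "B \<in> EXP" "infinite B" "\<And>w. w \<in> B \<Longrightarrow> Kt U w \<ge> ereal (real (length w))"
proof -
  obtain L where L: "L \<in> DTIME (\<lambda>n. 2 ^ (n ^ 2))"
    "\<And>w d t. prints_within U d t w \<Longrightarrow> length d < length w \<Longrightarrow> t < 2 ^ length w \<Longrightarrow> w \<in> L"
    "\<And>w. w \<in> L \<Longrightarrow> w \<noteq> [] \<Longrightarrow> \<exists>d t. length d < length w \<and> prints_within U d t w"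
    by (rule easy_words_EXP[OF wf det]) blast
  have "\<exists>w. length w = Suc n \<and> w \<in> - L" for n
    using exists_unprintable_word[OF wf det, of "Suc n"] L(3) by (metis Compl_iff length_0_conv nat.distinct(1))
  then have "Suc n \<in> length ` (- L)" for n by (metis image_eqI)
  then have "range Suc \<subseteq> length ` (- L)" by auto
  then have "infinite (- L)"
    using finite_subset[of "range Suc"] finite_imageD[of Suc UNIV] by (auto dest: finite_imageI)
  moreover have "- L \<in> EXP" using complement_DTIME[OF L(1)] unfolding EXP_def by blast
  moreover have "Kt U w \<ge> ereal (real (length w))" if "w \<in> - L" for w
    using that Kt_less_imp[of U w "length w"] L(2) by (metis Compl_iff not_le)
  ultimately show thesis using that by blast
qed

section \<open>Words in the range of a stretching function\<close>

lemma Kt_poly_time_function: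
  assumes U: "universal U" and g: "poly_time_function g"
  obtains K where "eventually (\<lambda>n. \<forall>x. length x = n \<longrightarrow>
     Kt U (g x) \<le> ereal (real n + K * log 2 (real n))) sequentially"
proof -
  obtain M :: "nat tm" and f c where M: "well_formed M" "deterministic M"
    and f: "\<And>x. prints_within M x (f (length x)) (g x)" "(\<lambda>n. real (f n)) \<in> O(\<lambda>n. real (n ^ c))"
    using g by (auto simp: poly_time_function_def)
  obtain p e where pe: "\<And>x t w. prints_within M x t w \<Longrightarrow>
      prints_within U (p @ x) ((length x + t) ^ e + e) w"
    using U M unfolding universal_def by metis
  obtain C where C: "C > 0" "eventually (\<lambda>n. real (f n) \<le> C * real (n ^ c)) sequentially"
    using f(2) by (auto elim!: landau_o.bigE)
  obtain m :: nat where m: "real m \<ge> C" using real_arch_simple by blast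
  let ?K = "real (length p) + real ((c + 2) * e + e)"
  have "eventually (\<lambda>n. n \<ge> m + 2) sequentially" by (rule eventually_ge_at_top)
  with C(2) have "eventually (\<lambda>n. \<forall>x. length x = n \<longrightarrow>
     Kt U (g x) \<le> ereal (real n + ?K * log 2 (real n))) sequentially"
  proof eventually_elim
    case (elim n)
    show ?case
    proof (intro allI impI)
      fix x :: word assume x: "length x = n"
      define t where "t = (n + f n) ^ e + e"
      have t1: "t \<ge> 1" unfolding t_def by (cases e) auto
      have pr: "prints_within U (p @ x) t (g x)"
        using pe[OF f(1)[of x]] by (simp add: t_def x)
      have "real (f n) \<le> real m * real (n ^ c)"
        using elim(1) m by (meson mult_right_mono of_nat_0_le_iff order_trans)
      then have "f n \<le> m * n ^ c" by (metis of_nat_le_iff of_nat_mult)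
      then have "n + f n \<le> n * n ^ c + m * n ^ c" using elim(2) by (intro add_mono) auto
      also have "\<dots> \<le> n * n ^ c + n * n ^ c" using elim(2) by (intro add_mono mult_right_mono) auto
      also have "\<dots> = 2 * (n * n ^ c)" by simp
      also have "\<dots> \<le> n * (n * n ^ c)" using elim(2) by (intro mult_right_mono) auto
      finally have nf: "n + f n \<le> n ^ (c + 2)" by simp
      have "t \<le> n ^ ((c + 2) * e + e)"
      proof (cases "e = 0")
        case False
        have "n ^ e \<ge> 2 ^ e" using elim(2) by (intro power_mono) auto
        then have ne: "n ^ e \<ge> 1 + e" using less_exp[of e] by linarith
        have "(n + f n) ^ e \<le> (n ^ (c + 2)) ^ e" using nf by (rule power_mono) simp
        also have "\<dots> = n ^ ((c + 2) * e)" by (rule power_mult[symmetric])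
        finally have 1: "(n + f n) ^ e \<le> n ^ ((c + 2) * e)" .
        have 2: "n ^ ((c + 2) * e) \<ge> 1" using elim(2) by simp
        have "t \<le> n ^ ((c + 2) * e) * (1 + e)"
          using add_mono[OF 1 mult_le_mono1[OF 2, of e]] unfolding t_def by simp
        also have "\<dots> \<le> n ^ ((c + 2) * e) * n ^ e" using ne by (rule mult_le_mono2)
        finally show ?thesis by (simp add: power_add)
      qed (simp add: t_def)
      then have "real t \<le> real n ^ ((c + 2) * e + e)" by (metis of_nat_le_iff of_nat_power)
      then have "log 2 (real t) \<le> log 2 (real n ^ ((c + 2) * e + e))"
        using t1 elim(2) by (subst log_le_cancel_iff) auto
      also have "\<dots> = real ((c + 2) * e + e) * log 2 (real n)"
        using elim(2) by (subst log_nat_power) auto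
      finally have lt: "log 2 (real t) \<le> real ((c + 2) * e + e) * log 2 (real n)" .
      have "log 2 (real n) \<ge> 1" using elim(2) by simp
      then have "real (length p) \<le> real (length p) * log 2 (real n)"
        using mult_left_mono[of 1 "log 2 (real n)" "real (length p)"] by simp
      with lt have "real (length (p @ x)) + log 2 (real t) \<le> real n + ?K * log 2 (real n)"
        using x by (simp add: algebra_simps)
      moreover have "Kt U (g x) \<le> ereal (real (length (p @ x)) + log 2 (real t))"
        unfolding Kt_def using t1 pr by (intro Inf_lower) blast
      ultimately show "Kt U (g x) \<le> ereal (real n + ?K * log 2 (real n))"
        by (meson ereal_less_eq(3) order_trans)
    qed
  qed
  then show thesis by (rule that)
qed

lemma Kt_stretching_function:
  assumes "universal U" "poly_time_function g" "stretches_superlog g"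
  shows "eventually (\<lambda>n. \<forall>x. length x = n \<longrightarrow> Kt U (g x) < ereal (real (length (g x)))) sequentially"
proof -
  obtain K where K: "eventually (\<lambda>n. \<forall>x. length x = n \<longrightarrow>
     Kt U (g x) \<le> ereal (real n + K * log 2 (real n))) sequentially"
    using Kt_poly_time_function[OF assms(1,2)] .
  obtain s where s: "(\<lambda>n. real (s n)) \<in> \<omega>(\<lambda>n. log 2 (real n))"
    "\<And>x. length (g x) \<ge> length x + s (length x)"
    using assms(3) by (auto simp: stretches_superlog_def)
  have "eventually (\<lambda>n. norm (real (s n)) \<ge> (\<bar>K\<bar> + 1) * norm (log 2 (real n))) sequentially"
    using s(1) by (rule landau_omega.smallD) simp
  with K eventually_ge_at_top[of 2] show ?thesis
  proof eventually_elim
    case (elim n)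
    have l: "log 2 (real n) \<ge> 1" using elim(2) by simp
    have "K * log 2 (real n) \<le> \<bar>K\<bar> * log 2 (real n)" using l by (intro mult_right_mono) auto
    also have "\<dots> < (\<bar>K\<bar> + 1) * log 2 (real n)" using l by (simp add: algebra_simps)
    also have "\<dots> \<le> real (s n)" using elim(3) l by simp
    finally have less: "K * log 2 (real n) < real (s n)" .
    show ?case
    proof (intro allI impI)
      fix x :: word assume x: "length x = n"
      have "real (length (g x)) \<ge> real n + real (s n)" using s(2)[of x] x by (metis of_nat_add of_nat_le_iff)
      with less have "ereal (real n + K * log 2 (real n)) < ereal (real (length (g x)))" by simp
      then show "Kt U (g x) < ereal (real (length (g x)))" using elim(1) x order_le_less_trans by blast
    qed
  qed
qed

lemma no_hitting_function:
  assumes U: "universal U" and A: "A \<in> NP" "infinite A"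
    and hard: "\<And>w. w \<in> A \<Longrightarrow> \<not> Kt U w < ereal (real (length w))"
    and g: "poly_time_function g" "stretches_superlog g"
  shows "\<exists>A' \<in> NP. infinite A' \<and> range g \<inter> A' = {}"
proof -
  obtain N where N: "\<And>x. length x \<ge> N \<Longrightarrow> Kt U (g x) < ereal (real (length (g x)))"
    using Kt_stretching_function[OF U g] by (auto simp: eventually_sequentially)
  have fin: "finite {x :: word. length x \<le> k}" for k
    using finite_lists_length_le[of "UNIV :: bool set" k] by simp
  define k where "k = Max (insert 0 ((\<lambda>x. length (g x)) ` {x. length x \<le> N}))"
  have k: "length (g x) \<le> k" if "length x \<le> N" for x
    unfolding k_def using fin[of N] that by (intro Max_ge) auto
  let ?A = "{x \<in> A. length x > k}"
  have "?A \<in> NP" by (rule filter_length_NP[OF A(1)])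
  moreover have "infinite ?A"
  proof
    assume "finite ?A"
    then have "finite (?A \<union> {x. length x \<le> k})" using fin by simp
    moreover have "A \<subseteq> ?A \<union> {x. length x \<le> k}" by auto
    ultimately show False using A(2) finite_subset by blast
  qed
  moreover have "g x \<notin> ?A" for x
    using hard[of "g x"] N[of x] k[of x] by (cases "length x \<ge> N") auto
  then have "range g \<inter> ?A = {}" by auto
  ultimately show ?thesis by blast
qed

theorem theorem1p7:
  fixes U :: "nat tm"
  assumes "universal U"
  shows "(every_infinite_NP_set_has_Kt_easy_string U \<longleftrightarrow>
            NP_immune {w. Kt U w \<ge> ereal (real (length w))}) \<and>
         (\<not> every_infinite_NP_set_has_Kt_easy_string U \<longrightarrow>
            \<not> (\<exists>g. poly_time_function g \<and> stretches_superlog g \<and>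
                  (\<forall>A \<in> NP. infinite A \<longrightarrow> range g \<inter> A \<noteq> {}))) \<and>
         (every_infinite_NP_set_has_Kt_easy_string U \<longrightarrow> NP \<subset> EXP)"
proof -
  let ?S = "{w. Kt U w \<ge> ereal (real (length w))}"
  obtain B where B: "B \<in> EXP" "infinite B" "\<And>w. w \<in> B \<Longrightarrow> Kt U w \<ge> ereal (real (length w))"
    using infinite_hard_EXP_set assms unfolding universal_def by metis
  have "infinite ?S" using B(2,3) finite_subset[of B ?S] by blast
  then have "every_infinite_NP_set_has_Kt_easy_string U \<longleftrightarrow> NP_immune ?S"
    unfolding every_infinite_NP_set_has_Kt_easy_string_def NP_immune_def by (auto simp: not_le subset_iff)
  moreover have "\<not> (\<exists>g. poly_time_function g \<and> stretches_superlog g \<and>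
                  (\<forall>A \<in> NP. infinite A \<longrightarrow> range g \<inter> A \<noteq> {}))"
    if "\<not> every_infinite_NP_set_has_Kt_easy_string U"
    using that no_hitting_function[OF assms] unfolding every_infinite_NP_set_has_Kt_easy_string_def by metis
  moreover have "NP \<subset> EXP" if "every_infinite_NP_set_has_Kt_easy_string U"
  proof -
    have "B \<notin> NP" using that B(2,3) unfolding every_infinite_NP_set_has_Kt_easy_string_def
      by (metis not_le)
    then show ?thesis using NP_subset_EXP B(1) by blast
  qed
  ultimately show ?thesis by blast
qed

end
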